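(* Let $D=\partial_t-\alpha(1-t)^{-1}+\beta(1+t)^{-1}$, with real $\alpha,\beta>-1$, be such that $\alpha$ and $\beta$ are not both zero. Then the following statements hold. (i) If $\alpha,\beta\in\mathbb N$, then the Strong Image Conjecture holds for $D$, i.e., $\mathfrak r(\mathrm{Im}'D)=\{0\}$. (ii) If $\alpha=\beta=\lambda-\frac12$ with $\lambda\in\frac12\mathbb N$, then $\mathfrak r(\mathrm{Im}'D)=\{0\}$.
   Context: $\mathbb N$ includes $0$. The operator $D$ maps $\mathbb C[t]$ into the rational functions $\mathbb C(t)$, with $\partial_t=d/dt$, and $\mathrm{Im}'D:=\mathbb C[t]\cap D(\mathbb C[t])$. For a subset $V$ of $\mathbb C[t]$, $\mathfrak r(V)=\{f\in\mathbb C[t] : f^m\in V\text{ for all sufficiently large } m\}$. The Strong Image Conjecture for $D$ (the differential operator associated with the Jacobi polynomials with parameters $\alpha,\beta>-1$) asserts that if $1\notin\mathrm{Im}'D$, then $\mathfrak r(\mathrm{Im}'D)=\{0\}$.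
   Formalization: In (i), if exactly one of α, β is 0, then 1 lies in Im'D (e.g. β=0: D(-(1-t)/(α+1))=1), so r(Im'D)={0} fails; (i) is stated as: the conditional Strong Image Conjecture for all such α, β, and r(Im'D)={0} when both are nonzero. *)

theory Defs
  imports "HOL-Analysis.Analysis" "HOL-Computational_Algebra.Computational_Algebra"
begin

definition jacobi_op :: "real \<Rightarrow> real \<Rightarrow> complex poly \<Rightarrow> complex poly fract" where
  "jacobi_op \<alpha> \<beta> f =
     to_fract (pderiv f)
     - to_fract [:of_real \<alpha>:] * inverse (to_fract [:1, -1:]) * to_fract f
     + to_fract [:of_real \<beta>:] * inverse (to_fract [:1, 1:]) * to_fract f"

text \<open>\<open>C[t] \<inter> D(C[t])\<close>, as a set of polynomials: the inclusion of \<open>C[t]\<close> in \<open>C(t)\<close> is \<open>to_fract\<close>.\<close>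

definition poly_image :: "(complex poly \<Rightarrow> complex poly fract) \<Rightarrow> complex poly set" where
  "poly_image D = {g. to_fract g \<in> range D}"

definition power_radical :: "complex poly set \<Rightarrow> complex poly set" where
  "power_radical V = {f. \<forall>\<^sub>F m in sequentially. f ^ m \<in> V}"

definition strong_image_conjecture :: "(complex poly \<Rightarrow> complex poly fract) \<Rightarrow> bool" where
  "strong_image_conjecture D \<longleftrightarrow> (1 \<notin> poly_image D \<longrightarrow> power_radical (poly_image D) = {0})"

text \<open>The premise of the Strong Image Conjecture cannot be dropped: if exactly one of the two
  parameters is 0, then \<open>1\<close> lies in the image, and hence in its radical.\<close>

lemma one_in_radical: "1 \<in> V \<Longrightarrow> 1 \<in> power_radical V"
  by (simp add: power_radical_def)

lemma one_in_poly_image_right_zero: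
  assumes "\<alpha> \<noteq> -1"
  shows "1 \<in> poly_image (jacobi_op \<alpha> 0)"
proof -
  define c :: complex where "c = 1 / (of_real \<alpha> + 1)"
  have nz: "of_real \<alpha> + 1 \<noteq> (0::complex)"
    using assms by (metis add_eq_0_iff of_real_1 of_real_eq_iff of_real_minus add.commute)
  have f: "[:- c, c:] = [:1, -1:] * [:- c:]" by simp
  have "to_fract [:- c, c:] = to_fract [:1, -1:] * to_fract [:- c:]"
    unfolding f by (rule to_fract_mult)
  then have "jacobi_op \<alpha> 0 [:- c, c:] = to_fract ([:c:] - [:of_real \<alpha>:] * [:- c:])"
    by (simp add: jacobi_op_def pderiv_pCons mult.assoc del: mult_pCons_left mult_pCons_right)
  also have "[:c:] - [:of_real \<alpha>:] * [:- c:] = 1"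
    using nz by (simp add: c_def one_pCons field_simps)
  finally show ?thesis
    by (auto simp: poly_image_def intro!: range_eqI[where x = "[:- c, c:]"])
qed

lemma one_in_poly_image_left_zero:
  assumes "\<beta> \<noteq> -1"
  shows "1 \<in> poly_image (jacobi_op 0 \<beta>)"
proof -
  define c :: complex where "c = 1 / (of_real \<beta> + 1)"
  have nz: "of_real \<beta> + 1 \<noteq> (0::complex)"
    using assms by (metis add_eq_0_iff of_real_1 of_real_eq_iff of_real_minus add.commute)
  have f: "[:c, c:] = [:1, 1:] * [:c:]" by simp
  have "to_fract [:c, c:] = to_fract [:1, 1:] * to_fract [:c:]"
    unfolding f by (rule to_fract_mult)
  then have "jacobi_op 0 \<beta> [:c, c:] = to_fract ([:c:] + [:of_real \<beta>:] * [:c:])"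
    by (simp add: jacobi_op_def pderiv_pCons mult.assoc del: mult_pCons_left mult_pCons_right)
  also have "[:c:] + [:of_real \<beta>:] * [:c:] = 1"
    using nz by (simp add: c_def one_pCons field_simps)
  finally show ?thesis
    by (auto simp: poly_image_def intro!: range_eqI[where x = "[:c, c:]"])
qed

end

theory Submission
  imports Defs "HOL-Complex_Analysis.Complex_Analysis"
begin

text \<open>
  Write \<open>w(t) = (1 - t)\<^sup>\<alpha> (1 + t)\<^sup>\<beta>\<close>, so that \<open>D f = (w f)' / w\<close>. If \<open>\<alpha>\<close> and \<open>\<beta>\<close> are both nonzero,
  then \<open>D f\<close> is a polynomial only if \<open>f\<close> vanishes at \<open>1\<close> and \<open>-1\<close>; hence the image consists of polynomials
  of mean zero with respect to the weight \<open>w\<close> on \<open>[-1, 1]\<close>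
  (\<open>mean_vanishes_on_image\<close>). So it suffices that a polynomial \<open>f \<noteq> 0\<close> cannot satisfy
  \<open>mean (f ^ m) = 0\<close> for all large \<open>m\<close>; this holds for all real \<open>\<alpha>, \<beta> > -1\<close>.
  For constant \<open>f\<close> it is obvious. If exactly one of the parameters is zero, then \<open>1\<close> is in the image and the conjecture holds vacuously.

  For nonconstant \<open>f\<close>, consider \<open>I(z) = mean (z / (z - f)) = \<Sum>\<^sub>m mean (f ^ m) / z ^ m\<close> for large \<open>z\<close>. If almost all of the
  means vanish, then \<open>I\<close> is a polynomial in \<open>1 / z\<close>, with constant term \<open>mean 1 = 1\<close>; in particular it does
  not tend to \<open>0\<close> as \<open>z \<rightarrow> 0\<close>. On the other hand, \<open>I\<close> can be computed from the roots \<open>t\<^sub>i(z)\<close> of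
  \<open>f(t) = z\<close>: partial fractions give \<open>I(z) = \<Sum>\<^sub>i z Q(t\<^sub>i(z)) / f'(t\<^sub>i(z))\<close>, where
  \<open>Q(\<tau>) = mean (1 / (\<tau> - t))\<close> is the Cauchy transform of the weight
  (\<open>sum_cauchy_over_fibre\<close>). After a rotation of \<open>f\<close>, a thin sector around the positive real axis contains
  no critical value of \<open>f\<close> and none of \<open>f(1)\<close>, \<open>f(-1)\<close>. Over this sector the roots are holomorphic
  functions \<open>t\<^sub>i\<close> (\<open>holomorphic_inverse_branches\<close>), and \<open>Q \<circ> t\<^sub>i\<close> continues holomorphically, because \<open>Q\<close>
  solves a linear differential equation of first order whose only singular points are \<open>1\<close> and \<open>-1\<close>
  (\<open>cauchy_continuation\<close>). So the formula persists along the positive real axis down to \<open>0\<close>.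

  There each summand tends to \<open>0\<close> (\<open>branch_contribution_vanishes\<close>): \<open>t\<^sub>i(z)\<close> approaches a root \<open>\<rho>\<close> of
  \<open>f\<close>, the factor \<open>z / f'(t\<^sub>i(z))\<close> is of the order of \<open>t\<^sub>i(z) - \<rho>\<close>, and the continued Cauchy transform grows
  more slowly than the inverse of this, even if \<open>\<rho>\<close> is \<open>1\<close> or \<open>-1\<close>, because \<open>\<alpha>, \<beta> > -1\<close>. Thus \<open>I(z) \<rightarrow> 0\<close>,
  a contradiction.
\<close>

section \<open>The mean against the Jacobi weight\<close>

locale jacobi_parameters =
  fixes a b :: real
  assumes a_gt: "a > -1" and b_gt: "b > -1"
begin

text \<open>The moments of the weight on \<open>[-1, 1]\<close>, divided by its total mass. The recurrence is the vanishing of the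
integral of \<open>w D((1 - t\<^sup>2) t ^ k) = (w (1 - t\<^sup>2) t ^ k)'\<close>. Taking it as the definition makes the
functional purely algebraic: no singular integral is needed for negative parameters.\<close>

fun moment :: "nat \<Rightarrow> real" where
  "moment 0 = 1"
| "moment (Suc k) = (real k * moment (k - 1) + (b - a) * moment k) / (real k + 2 + a + b)"

declare moment.simps(2) [simp del]

lemma moment_recurrence:
  "(real k + 2 + a + b) * moment (Suc k) = real k * moment (k - 1) + (b - a) * moment k"
  using a_gt b_gt by (simp add: moment.simps(2))

text \<open>By induction: since \<open>a, b > -1\<close>, the coefficients of the recurrence satisfy \<open>k + \<bar>b - a\<bar> \<le> k + 2 + a + b\<close>.\<close>

lemma abs_moment_le_1: "\<bar>moment k\<bar> \<le> 1"
proof (induction k rule: less_induct)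
  case (less n)
  show ?case
  proof (cases n)
    case (Suc k)
    have "\<bar>real k * moment (k - 1)\<bar> \<le> real k" "\<bar>(b - a) * moment k\<bar> \<le> \<bar>b - a\<bar>"
      using less.IH[of "k - 1"] less.IH[of k] Suc by (auto simp: abs_mult mult_left_le)
    then have "\<bar>real k * moment (k - 1) + (b - a) * moment k\<bar> \<le> real k + 2 + a + b"
      using a_gt b_gt by linarith
    then show ?thesis
      using Suc a_gt b_gt by (simp add: moment.simps(2) abs_divide)
  qed simp
qed

text \<open>The functional \<open>p \<mapsto> (\<integral> p w) / (\<integral> w)\<close>, the integrals being over \<open>[-1, 1]\<close>.\<close>

definition mean :: "complex poly \<Rightarrow> complex" where
  "mean p = (\<Sum>k\<le>degree p. coeff p k * of_real (moment k))"

lemma mean_eq_sum: "degree p \<le> n \<Longrightarrow> mean p = (\<Sum>k\<le>n. coeff p k * of_real (moment k))"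
  unfolding mean_def by (rule sum.mono_neutral_left) (auto simp: coeff_eq_0)

lemma mean_add: "mean (p + q) = mean p + mean q"
proof -
  let ?n = "max (degree p) (degree q)"
  have "degree (p + q) \<le> ?n" by (rule degree_add_le) auto
  then show ?thesis
    by (simp add: mean_eq_sum[where n = ?n] sum.distrib ring_distribs)
qed

lemma mean_smult: "mean (smult c p) = c * mean p"
  using mean_eq_sum[of "smult c p" "degree p"] by (simp add: mean_def sum_distrib_left mult.assoc)

lemma mean_0 [simp]: "mean 0 = 0" by (simp add: mean_def)
lemma mean_1 [simp]: "mean 1 = 1" by (simp add: mean_def)

lemma mean_diff: "mean (p - q) = mean p - mean q"
  using mean_add[of p "smult (-1) q"] mean_smult[of "-1" q] by simp

lemma mean_sum: "mean (\<Sum>i\<in>I. p i) = (\<Sum>i\<in>I. mean (p i))"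
  by (induction I rule: infinite_finite_induct) (auto simp: mean_add)

lemma mean_monom [simp]: "mean (monom c k) = c * of_real (moment k)"
proof -
  have "mean (monom c k) = (\<Sum>i\<le>k. coeff (monom c k) i * of_real (moment i))"
    by (rule mean_eq_sum) (rule degree_monom_le)
  also have "\<dots> = (\<Sum>i\<le>k. if k = i then c * of_real (moment i) else 0)"
    by (rule sum.cong) auto
  finally show ?thesis by simp
qed

text \<open>The argument is \<open>D ((1 - t\<^sup>2) h)\<close>. On monomials \<open>h\<close> this is the recurrence for the moments.\<close>

lemma mean_conjugated_derivative:
  "mean (pderiv ([:1, 0, -1:] * h) - smult (of_real a) ([:1, 1:] * h)
        + smult (of_real b) ([:1, -1:] * h)) = 0" (is "mean (?D h) = 0")
proof -
  have D_add: "?D (p + q) = ?D p + ?D q" for p q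
    by (simp only: distrib_left pderiv_add smult_add_right) simp
  have D_sum: "?D (\<Sum>i\<in>I. g i) = (\<Sum>i\<in>I. ?D (g i))" for I :: "nat set" and g
  proof (induction I rule: infinite_finite_induct)
    case (insert i I)
    then show ?case by (simp only: sum.insert[OF insert.hyps] D_add)
  qed simp_all
  have D_monom: "mean (?D (monom c k)) = 0" for c k
  proof -
    have shifts: "[:1, 0, -1:] * monom c k = monom c k - monom c (Suc (Suc k))"
      "[:1, 1:] * monom c k = monom c k + monom c (Suc k)"
      "[:1, -1:] * monom c k = monom c k - monom c (Suc k)"
      by (simp_all add: monom_Suc minus_monom)
    have "complex_of_real ((real k + 2 + a + b) * moment (Suc k))
        = of_real (real k * moment (k - 1) + (b - a) * moment k)"
      by (simp only: moment_recurrence)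
    from arg_cong[OF this, of "(*) c"] show ?thesis
      unfolding shifts
      by (simp add: mean_add mean_diff mean_smult pderiv_diff pderiv_monom algebra_simps)
  qed
  have "h = (\<Sum>i\<le>degree h. monom (coeff h i) i)"
    by (simp add: poly_as_sum_of_monoms)
  then have "mean (?D h) = mean (?D (\<Sum>i\<le>degree h. monom (coeff h i) i))" by simp
  also have "\<dots> = (\<Sum>i\<le>degree h. mean (?D (monom (coeff h i) i)))"
    unfolding D_sum mean_sum ..
  finally show ?thesis using D_monom by simp
qed

text \<open>After multiplication by \<open>1 - t\<^sup>2\<close>, evaluation of \<open>D f\<close> at \<open>1\<close> and \<open>-1\<close> leaves only the terms
\<open>\<alpha> f(1)\<close> and \<open>\<beta> f(-1)\<close>. So \<open>f\<close> is divisible by \<open>1 - t\<^sup>2\<close>, and \<open>mean_conjugated_derivative\<close> applies.\<close>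

lemma mean_vanishes_on_image:
  assumes "a \<noteq> 0" "b \<noteq> 0" "g \<in> poly_image (jacobi_op a b)"
  shows "mean g = 0"
proof -
  obtain f where f: "to_fract g = jacobi_op a b f"
    using assms(3) by (auto simp: poly_image_def)
  let ?u = "[:1, -1:] :: complex poly" and ?v = "[:1, 1:] :: complex poly"
  let ?U = "to_fract ?u" and ?V = "to_fract ?v"
  have nz: "?U \<noteq> 0" "?V \<noteq> 0" by auto
  have cancel: "?U * inverse ?U = 1" "?V * inverse ?V = 1" using nz by auto
  have "?U * ?V * to_fract g
      = ?U * ?V * to_fract (pderiv f)
        - to_fract [:of_real a:] * ?V * to_fract f * (?U * inverse ?U)
        + to_fract [:of_real b:] * ?U * to_fract f * (?V * inverse ?V)"
    unfolding f jacobi_op_def by (simp add: algebra_simps)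
  then have "to_fract (?u * ?v * g)
      = to_fract (?u * ?v * pderiv f - [:of_real a:] * ?v * f + [:of_real b:] * ?u * f)"
    unfolding cancel by (simp del: mult_pCons_left mult_pCons_right)
  then have eq: "?u * ?v * g = ?u * ?v * pderiv f - [:of_real a:] * ?v * f + [:of_real b:] * ?u * f"
    by (simp only: to_fract_eq_iff)
  have "poly f 1 = 0" using arg_cong[OF eq, of "\<lambda>p. poly p 1"] assms(1) by simp
  then obtain f1 where f1: "f = [:-1, 1:] * f1" by (auto simp: poly_eq_0_iff_dvd)
  have "poly f (-1) = 0" using arg_cong[OF eq, of "\<lambda>p. poly p (-1)"] assms(2) by simp
  then have "poly f1 (-1) = 0" unfolding f1 by simp
  then obtain f2 where f2: "f1 = [:1, 1:] * f2" by (auto simp: poly_eq_0_iff_dvd)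
  define h where "h = - f2"
  have fh: "f = ?u * ?v * h" unfolding f1 f2 h_def by simp
  have uv: "?u * ?v = [:1, 0, -1:]" by simp
  have "?u * ?v * g = ?u * ?v * (pderiv (?u * ?v * h) - [:of_real a:] * ?v * h + [:of_real b:] * ?u * h)"
    unfolding eq unfolding fh by (simp only: ring_distribs) (simp only: ac_simps right_diff_distrib)
  then have "g = pderiv (?u * ?v * h) - [:of_real a:] * ?v * h + [:of_real b:] * ?u * h"
    by (subst (asm) mult_cancel_left) simp
  also have "[:of_real a:] * ?v * h = smult (of_real a) (?v * h)" by (simp add: smult_add_right)
  also have "[:of_real b:] * ?u * h = smult (of_real b) (?u * h)" by (simp add: smult_add_right)
  finally show ?thesis
    using mean_conjugated_derivative[of h] by (simp only: uv)
qed

end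

section \<open>Simple fibres of a polynomial\<close>

definition coeff_norm :: "complex poly \<Rightarrow> real" where
  "coeff_norm p = (\<Sum>k\<le>degree p. cmod (coeff p k))"

lemma coeff_norm_nonneg: "coeff_norm p \<ge> 0"
  unfolding coeff_norm_def by (intro sum_nonneg) auto

lemma norm_poly_le_coeff_norm:
  assumes "cmod x \<le> 1"
  shows "cmod (poly p x) \<le> coeff_norm p"
  unfolding poly_altdef coeff_norm_def
proof (rule sum_norm_le)
  fix k
  show "cmod (coeff p k * x ^ k) \<le> cmod (coeff p k)"
    using assms by (simp add: norm_mult norm_power mult_left_le power_le_one)
qed

lemma
  fixes f :: "complex poly"
  assumes deg: "degree f > 0" and simple: "\<And>x. poly f x = z \<Longrightarrow> poly (pderiv f) x \<noteq> 0"
  shows finite_simple_fibre: "finite {x. poly f x = z}"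
    and card_simple_fibre: "card {x. poly f x = z} = degree f"
proof -
  let ?g = "f - [:z:]"
  have fibre: "{x. poly f x = z} = {x. poly ?g x = 0}" by simp
  have "degree ?g = degree f" unfolding diff_conv_add_uminus
    using deg by (intro degree_add_eq_left) simp
  moreover have "?g \<noteq> 0" using calculation deg by auto
  moreover have "rsquarefree ?g"
    using simple by (auto simp: rsquarefree_roots pderiv_diff)
  ultimately have eq: "smult (lead_coeff ?g) (\<Prod>x | poly ?g x = 0. [:-x, 1:]) = ?g"
    and nz: "?g \<noteq> 0" and deg_g: "degree ?g = degree f"
    using complex_poly_decompose_rsquarefree by blast+
  show "finite {x. poly f x = z}"
    unfolding fibre by (rule poly_roots_finite[OF nz])
  have "degree ?g = degree (smult (lead_coeff ?g) (\<Prod>x | poly ?g x = 0. [:-x, 1:]))"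
    by (simp only: eq)
  also have "\<dots> = degree (\<Prod>x | poly ?g x = 0. [:-x, 1:])"
    using nz by (simp only: degree_smult_eq leading_coeff_0_iff if_False)
  also have "\<dots> = card {x. poly ?g x = 0}"
    by (simp add: degree_prod_eq_sum_degree)
  finally show "card {x. poly f x = z} = degree f"
    unfolding fibre using deg_g by simp
qed

text \<open>Lagrange interpolation of the constant \<open>1\<close> at the points of a simple fibre: the quotient
\<open>synthetic_div f x = (f - z) / (t - x)\<close> vanishes at the other points and has the value \<open>f'(x)\<close> at \<open>x\<close>.
Division by \<open>f - z\<close> turns this into the partial fraction decomposition of \<open>1 / (f - z)\<close>.\<close>

lemma lagrange_partition_of_unity:
  fixes f :: "complex poly"
  assumes deg: "degree f > 0" and simple: "\<And>x. poly f x = z \<Longrightarrow> poly (pderiv f) x \<noteq> 0"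
  shows "(\<Sum>x | poly f x = z. smult (1 / poly (pderiv f) x) (synthetic_div f x)) = 1" (is "?s = 1")
proof -
  let ?R = "{x. poly f x = z}"
  have fin: "finite ?R" and card: "card ?R = degree f"
    by (rule finite_simple_fibre[OF deg simple] card_simple_fibre[OF deg simple]; assumption)+
  have div: "f = [:-x, 1:] * synthetic_div f x + [:z:]" if "x \<in> ?R" for x
    using synthetic_div_correct'[of x f] that by simp
  have at_self: "poly (synthetic_div f x) x = poly (pderiv f) x" if "x \<in> ?R" for x
    by (subst (2) div[OF that]) (simp add: pderiv_mult pderiv_pCons pderiv_add del: mult_pCons_left)
  have at_other: "poly (synthetic_div f x) y = 0" if "x \<in> ?R" "y \<in> ?R" "x \<noteq> y" for x y
    using arg_cong[OF div[OF that(1)], of "\<lambda>p. poly p y"] that by simp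
  have "poly ?s y = 1" if y: "y \<in> ?R" for y
  proof -
    have "poly ?s y = (\<Sum>x\<in>?R. if x = y then 1 else 0)"
      unfolding poly_sum
      by (rule sum.cong) (use at_self at_other simple y in auto)
    also have "\<dots> = 1" using fin y by simp
    finally show ?thesis .
  qed
  then have roots: "?R \<subseteq> {y. poly (?s - 1) y = 0}" by auto
  have "degree ?s \<le> degree f - 1"
    by (rule degree_sum_le[OF fin]) (rule order.trans[OF degree_smult_le], simp add: degree_synthetic_div)
  then have "degree (?s - 1) < degree f"
    using deg by (intro degree_diff_less) auto
  show ?thesis
  proof (rule ccontr)
    assume "?s \<noteq> 1"
    then have nz: "?s - 1 \<noteq> 0" by simp
    have "degree f \<le> card {y. poly (?s - 1) y = 0}"
      using card_mono[OF poly_roots_finite[OF nz] roots] card by simp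
    also have "\<dots> \<le> degree (?s - 1)" by (rule card_poly_roots_bound[OF nz])
    finally show False using \<open>degree (?s - 1) < degree f\<close> by simp
  qed
qed

section \<open>The Cauchy transform of the weight\<close>

context jacobi_parameters
begin

text \<open>The shift by \<open>monom 1 k\<close> makes the induction work: one factor \<open>f\<close> is expanded into monomials, which are
absorbed into the shift.\<close>

lemma norm_mean_shifted_power: "cmod (mean (monom 1 k * f ^ m)) \<le> coeff_norm f ^ m"
proof (induction m arbitrary: k)
  case 0
  show ?case using abs_moment_le_1[of k] by simp
next
  case (Suc m)
  have "monom 1 k * f ^ Suc m = monom 1 k * ((\<Sum>i\<le>degree f. monom (coeff f i) i) * f ^ m)"
    by (simp add: poly_as_sum_of_monoms)
  also have "\<dots> = (\<Sum>i\<le>degree f. smult (coeff f i) (monom 1 (k + i) * f ^ m))"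
    unfolding sum_distrib_left sum_distrib_right
    by (rule sum.cong) (simp_all add: mult_monom smult_monom mult.assoc[symmetric] flip: mult_smult_left)
  finally have "mean (monom 1 k * f ^ Suc m) = (\<Sum>i\<le>degree f. coeff f i * mean (monom 1 (k + i) * f ^ m))"
    by (simp add: mean_sum mean_smult)
  also have "cmod \<dots> \<le> (\<Sum>i\<le>degree f. cmod (coeff f i) * coeff_norm f ^ m)"
    by (rule sum_norm_le) (simp add: norm_mult mult_left_mono Suc.IH)
  finally show ?case
    by (simp add: coeff_norm_def sum_distrib_right)
qed

text \<open>The series of \<open>mean (p / (\<tau> - t))\<close> at \<open>\<tau> = \<infinity>\<close>, that is, the Cauchy transform of \<open>p w\<close> (up to normalisation).\<close>

definition cauchy_transform :: "complex \<Rightarrow> complex poly \<Rightarrow> complex" where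
  "cauchy_transform \<tau> p = (\<Sum>k. mean (monom 1 k * p) * (1 / \<tau>) ^ Suc k)"

lemma
  assumes "cmod \<tau> > 1" and bound: "\<And>k. cmod (mean (monom 1 k * p)) \<le> B"
  shows summable_cauchy': "summable (\<lambda>k. mean (monom 1 k * p) * (1 / \<tau>) ^ Suc k)"
    and norm_cauchy_le: "cmod (cauchy_transform \<tau> p) \<le> B / (cmod \<tau> - 1)"
proof -
  let ?q = "1 / cmod \<tau>"
  have q: "0 < ?q" "?q < 1" using assms(1) by (auto simp: divide_less_eq)
  have sums: "(\<lambda>k. B * ?q ^ Suc k) sums (B * (1 / (1 - ?q) * ?q))"
    using sums_mult[OF sums_mult2[OF geometric_sums[of ?q], of ?q], of B] q
    by (simp add: mult.commute mult.left_commute)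
  have le: "cmod (mean (monom 1 k * p) * (1 / \<tau>) ^ Suc k) \<le> B * ?q ^ Suc k" for k
    unfolding norm_mult norm_power norm_divide norm_one
    by (intro mult_right_mono bound) auto
  show "summable (\<lambda>k. mean (monom 1 k * p) * (1 / \<tau>) ^ Suc k)"
    by (rule summable_comparison_test'[OF sums_summable[OF sums] le])
  have "cmod (cauchy_transform \<tau> p) \<le> (\<Sum>k. B * ?q ^ Suc k)"
    unfolding cauchy_transform_def by (rule norm_suminf_le[OF le sums_summable[OF sums]])
  also have "\<dots> = B * (1 / (1 - ?q) * ?q)"
    by (rule sums_unique[OF sums, symmetric])
  also have "\<dots> = B / (cmod \<tau> - 1)"
    using q assms(1) by (simp add: field_simps)
  finally show "cmod (cauchy_transform \<tau> p) \<le> B / (cmod \<tau> - 1)" .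
qed

lemma summable_cauchy:
  "cmod \<tau> > 1 \<Longrightarrow> summable (\<lambda>k. mean (monom 1 k * p) * (1 / \<tau>) ^ Suc k)"
  by (rule summable_cauchy'[where B = "coeff_norm p"])
     (use norm_mean_shifted_power[where m = 1 and f = p] in auto)

lemma cauchy_diff:
  "cmod \<tau> > 1 \<Longrightarrow> cauchy_transform \<tau> (p - q) = cauchy_transform \<tau> p - cauchy_transform \<tau> q"
  unfolding cauchy_transform_def right_diff_distrib mean_diff left_diff_distrib
  by (rule suminf_diff[symmetric]) (rule summable_cauchy, assumption)+

lemma cauchy_smult: "cmod \<tau> > 1 \<Longrightarrow> cauchy_transform \<tau> (smult c p) = c * cauchy_transform \<tau> p"
  unfolding cauchy_transform_def mult_smult_right mean_smult mult.assoc
  by (rule suminf_mult) (rule summable_cauchy)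

text \<open>Multiplying \<open>p\<close> by \<open>t - \<tau>\<close> cancels the denominator; on the level of series the sum telescopes.\<close>

lemma cauchy_linear_factor:
  assumes "cmod \<tau> > 1"
  shows "cauchy_transform \<tau> ([:-\<tau>, 1:] * p) = - mean p"
proof -
  let ?s = "\<lambda>k. mean (monom 1 k * p) * (1 / \<tau>) ^ k"
  have nz: "\<tau> \<noteq> 0" using assms by auto
  have summ: "summable ?s"
    using summable_mult[OF summable_cauchy[OF assms, of p], of \<tau>] nz by (simp add: mult.left_commute)
  have "monom 1 k * ([:-\<tau>, 1:] * p) = monom 1 (Suc k) * p - smult \<tau> (monom 1 k * p)" for k
    by (simp add: monom_Suc algebra_simps)
  then have "mean (monom 1 k * ([:-\<tau>, 1:] * p)) * (1 / \<tau>) ^ Suc k = ?s (Suc k) - ?s k" for k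
    using nz by (simp add: mean_diff mean_smult field_simps)
  then have "cauchy_transform \<tau> ([:-\<tau>, 1:] * p) = (\<Sum>k. ?s (Suc k) - ?s k)"
    unfolding cauchy_transform_def by simp
  also have "\<dots> = - ?s 0"
    using telescope_sums[OF summable_LIMSEQ_zero[OF summ]] by (simp add: sums_iff)
  finally show ?thesis by (simp add: monom_0 one_pCons[symmetric])
qed

text \<open>As \<open>f - z\<close> is divisible by \<open>t - x\<close>, so is \<open>f ^ M - z ^ M\<close>, and \<open>cauchy_linear_factor\<close> turns its Cauchy transform into
an ordinary mean.\<close>

lemma cauchy_power_of_fibre:
  assumes "cmod x > 1" "poly f x = z"
  shows "cauchy_transform x (f ^ M) = z ^ M * cauchy_transform x 1
           - mean (synthetic_div f x * (\<Sum>i<M. smult (z ^ (M - Suc i)) (f ^ i)))"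
proof -
  let ?S = "\<Sum>i<M. smult (z ^ (M - Suc i)) (f ^ i)"
  have z_pow: "[:z:] ^ n = [:z ^ n:]" for n by (induction n) (auto simp: one_pCons)
  have const_mult: "[:c:] * p = smult c p" for c :: complex and p by simp
  have "f ^ M - [:z:] ^ M = (f - [:z:]) * (\<Sum>i<M. [:z:] ^ (M - Suc i) * f ^ i)"
    by (rule power_diff_sumr2)
  also have "f - [:z:] = [:-x, 1:] * synthetic_div f x"
    using synthetic_div_correct'[of x f] assms(2) by (metis add_diff_cancel_right')
  finally have "f ^ M - smult (z ^ M) 1 = [:-x, 1:] * (synthetic_div f x * ?S)"
    by (simp add: z_pow const_mult mult.assoc del: mult_pCons_left)
  from arg_cong[OF this, of "cauchy_transform x"] show ?thesis
    unfolding cauchy_linear_factor[OF assms(1)] cauchy_diff[OF assms(1)] cauchy_smult[OF assms(1)]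
    by (simp add: algebra_simps)
qed

text \<open>Both sides are \<open>mean (1 / (z - f))\<close>: the left one by partial fractions, the right one by the geometric
series. To stay within polynomials, the geometric series is truncated at \<open>M\<close>. Applying \<open>cauchy_power_of_fibre\<close>
at each point of the fibre, and \<open>lagrange_partition_of_unity\<close> to the sum, leaves an error that is
bounded by a multiple of \<open>(coeff_norm f / cmod z) ^ M\<close>.\<close>

lemma sum_cauchy_over_fibre:
  assumes deg: "degree f > 0" and simple: "\<And>x. poly f x = z \<Longrightarrow> poly (pderiv f) x \<noteq> 0"
    and z: "cmod z > coeff_norm f" and vanish: "\<And>m. m \<ge> N \<Longrightarrow> mean (f ^ m) = 0"
  shows "(\<Sum>x | poly f x = z. cauchy_transform x 1 / poly (pderiv f) x) = (\<Sum>m<N. mean (f ^ m) / z ^ Suc m)"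
    (is "?A = ?B")
proof -
  let ?R = "{x. poly f x = z}"
  let ?w = "\<lambda>x. 1 / poly (pderiv f) x"
  have z0: "z \<noteq> 0" "cmod z > 0" using z coeff_norm_nonneg[of f] by auto
  have big: "cmod x > 1" if "x \<in> ?R" for x
    using norm_poly_le_coeff_norm[of x f] that z by force
  define K where "K = (\<Sum>x\<in>?R. cmod (?w x) / (cmod x - 1))"
  have error: "(?A - ?B) * z ^ M = (\<Sum>x\<in>?R. ?w x * cauchy_transform x (f ^ M))" if M: "M \<ge> N" for M
  proof -
    let ?S = "\<Sum>i<M. smult (z ^ (M - Suc i)) (f ^ i)"
    have "(\<Sum>x\<in>?R. ?w x * cauchy_transform x (f ^ M))
        = (\<Sum>x\<in>?R. ?w x * cauchy_transform x 1 * z ^ M - mean (smult (?w x) (synthetic_div f x) * ?S))"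
      by (rule sum.cong) (use big in \<open>auto simp: cauchy_power_of_fibre mean_smult algebra_simps\<close>)
    also have "\<dots> = ?A * z ^ M - mean ((\<Sum>x\<in>?R. smult (?w x) (synthetic_div f x)) * ?S)"
      unfolding sum_subtractf mean_sum sum_distrib_right by simp
    also have "(\<Sum>x\<in>?R. smult (?w x) (synthetic_div f x)) = 1"
      by (rule lagrange_partition_of_unity[OF deg simple])
    also have "mean (1 * ?S) = (\<Sum>i<M. z ^ (M - Suc i) * mean (f ^ i))"
      by (simp add: mean_sum mean_smult)
    also have "\<dots> = (\<Sum>i<N. z ^ (M - Suc i) * mean (f ^ i))"
      using M vanish by (intro sum.mono_neutral_right) auto
    also have "\<dots> = ?B * z ^ M"
      unfolding sum_distrib_right
      by (rule sum.cong) (use M z0 in \<open>auto simp: power_diff\<close>)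
    finally show ?thesis by (simp add: algebra_simps)
  qed
  have bound: "cmod (?A - ?B) \<le> K * (coeff_norm f / cmod z) ^ M" if M: "M \<ge> N" for M
  proof -
    have "cmod (?A - ?B) * cmod z ^ M = cmod (\<Sum>x\<in>?R. ?w x * cauchy_transform x (f ^ M))"
      by (simp only: error[OF M, symmetric] norm_mult norm_power)
    also have "\<dots> \<le> (\<Sum>x\<in>?R. cmod (?w x) * (coeff_norm f ^ M / (cmod x - 1)))"
    proof (rule sum_norm_le)
      fix x assume "x \<in> ?R"
      then show "cmod (?w x * cauchy_transform x (f ^ M)) \<le> cmod (?w x) * (coeff_norm f ^ M / (cmod x - 1))"
        unfolding norm_mult
        by (intro mult_left_mono norm_cauchy_le big norm_mean_shifted_power) auto
    qed
    also have "\<dots> = K * coeff_norm f ^ M"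
      unfolding K_def sum_distrib_right by (intro sum.cong) auto
    finally show ?thesis using z0 by (simp add: field_simps)
  qed
  have "(\<lambda>M. K * (coeff_norm f / cmod z) ^ M) \<longlonglongrightarrow> K * 0"
    using z z0 coeff_norm_nonneg[of f]
    by (intro tendsto_mult tendsto_const LIMSEQ_power_zero) auto
  then have "cmod (?A - ?B) \<le> K * 0"
    by (rule tendsto_lowerbound) (use bound in \<open>auto simp: eventually_sequentially\<close>)
  then show ?thesis by simp
qed

text \<open>This is the recurrence for the moments again, summed as a power series in \<open>1 / x\<close>. The
homogeneous equation is solved by the analytic continuation of the weight, \<open>(x - 1)\<^sup>a (x + 1)\<^sup>b\<close>.\<close>

lemma cauchy_transform_differential_equation:
  assumes x: "cmod x > 1"
  shows "((\<lambda>t. cauchy_transform t 1) has_field_derivative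
           (of_real (1 + a + b) - (of_real (a + b) * x + of_real (a - b)) * cauchy_transform x 1) / (1 - x\<^sup>2)) (at x)"
proof -
  let ?m = "\<lambda>k. complex_of_real (moment k)"
  let ?y = "1 / x"
  have x0: "x \<noteq> 0" using x by auto
  have y: "cmod ?y < 1" "?y \<noteq> 0" using x x0 by (auto simp: norm_divide divide_less_eq)
  have summ: "summable (\<lambda>k. ?m k * w ^ k)" if "cmod w < 1" for w
  proof (rule summable_comparison_test'[OF summable_geometric])
    show "norm (cmod w) < 1" using that by simp
    fix k show "cmod (?m k * w ^ k) \<le> cmod w ^ k"
      using abs_moment_le_1[of k] by (simp add: norm_mult norm_power mult_left_le_one_le)
  qed
  define g where "g w = (\<Sum>k. ?m k * w ^ k)" for w
  define g' where "g' w = (\<Sum>k. diffs ?m k * w ^ k)" for w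
  have g_deriv: "(g has_field_derivative g' ?y) (at ?y)"
    unfolding g_def g'_def by (rule termdiffs_strong'[OF summ y(1)])
  have cauchy_eq: "cauchy_transform t 1 = 1 / t * g (1 / t)" if "cmod t > 1" for t
  proof -
    have "cmod (1 / t) < 1" using that by (simp add: norm_divide divide_less_eq)
    from suminf_mult[OF summ[OF this], of "1 / t"] show ?thesis
      unfolding cauchy_transform_def g_def by (simp add: mult_ac)
  qed
  have g_sums: "(\<lambda>k. ?m k * ?y ^ k) sums g ?y"
    unfolding g_def by (rule summable_sums[OF summ[OF y(1)]])
  have g'_sums: "(\<lambda>k. (of_nat k + 1) * ?m (Suc k) * ?y ^ k) sums g' ?y"
    unfolding g'_def using summable_sums[OF termdiff_converges[OF y(1) summ]]
    by (simp add: diffs_def add.commute)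
  have yg'_sums: "(\<lambda>k. of_nat k * ?m k * ?y ^ k) sums (?y * g' ?y)"
    using sums_Suc[of "\<lambda>k. of_nat k * ?m k * ?y ^ k", OF sums_cong[THEN iffD1, OF _ sums_mult[OF g'_sums, of ?y]]]
    by (simp add: algebra_simps)
  \<comment> \<open>multiply the recurrence for \<open>moment (Suc k)\<close> by \<open>?y ^ Suc k\<close> and sum; \<open>C\<close> is the term of exponent \<open>0\<close>, which the sum omits\<close>
  define C where "C = complex_of_real (1 + a + b)"
  have "(\<lambda>k. (of_nat k + C) * ?m k * ?y ^ k) sums (?y * g' ?y + C * g ?y)"
    using sums_add[OF yg'_sums sums_mult[OF g_sums, of C]] by (simp add: algebra_simps)
  then have lhs: "(\<lambda>k. (of_nat (Suc k) + C) * ?m (Suc k) * ?y ^ Suc k) sums (?y * g' ?y + C * g ?y - C)"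
    using sums_Suc_iff[of "\<lambda>k. (of_nat k + C) * ?m k * ?y ^ k"] by simp
  have recurrence: "(of_nat (Suc k) + C) * ?m (Suc k) * ?y ^ Suc k
      = of_nat k * ?m (k - 1) * ?y ^ Suc k + of_real (b - a) * ?y * (?m k * ?y ^ k)" for k
  proof -
    have "of_nat (Suc k) + C = complex_of_real (real k + 2 + a + b)" by (simp add: C_def)
    then have "(of_nat (Suc k) + C) * ?m (Suc k) = of_real (real k * moment (k - 1) + (b - a) * moment k)"
      by (simp only: moment_recurrence flip: of_real_mult)
    from arg_cong[OF this, of "\<lambda>t. t * ?y ^ Suc k"] show ?thesis
      by (simp only: of_real_add of_real_mult of_real_of_nat_eq power_Suc) (simp add: algebra_simps)
  qed
  have rhs: "(\<lambda>k. of_nat k * ?m (k - 1) * ?y ^ Suc k) sums (?y\<^sup>2 * (?y * g' ?y + g ?y))"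
  proof -
    have "(\<lambda>k. ?y\<^sup>2 * (of_nat k * ?m k * ?y ^ k + ?m k * ?y ^ k)) sums (?y\<^sup>2 * (?y * g' ?y + g ?y))"
      by (intro sums_mult sums_add yg'_sums g_sums)
    then have "(\<lambda>k. of_nat (Suc k) * ?m (Suc k - 1) * ?y ^ Suc (Suc k)) sums (?y\<^sup>2 * (?y * g' ?y + g ?y))"
      by (simp add: algebra_simps power2_eq_square)
    from sums_Suc[OF this] show ?thesis by simp
  qed
  from sums_add[OF rhs sums_mult[OF g_sums, of "of_real (b - a) * ?y"]]
  have "(\<lambda>k. (of_nat (Suc k) + C) * ?m (Suc k) * ?y ^ Suc k) sums
      (?y\<^sup>2 * (?y * g' ?y + g ?y) + of_real (b - a) * ?y * g ?y)"
    by (simp only: recurrence)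
  from sums_unique2[OF lhs this]
  have ode: "?y * (1 - ?y\<^sup>2) * g' ?y = C - C * g ?y + ?y\<^sup>2 * g ?y + of_real (b - a) * ?y * g ?y"
    by (simp add: algebra_simps)
  have "((\<lambda>t. 1 / t * g (1 / t)) has_field_derivative
          - (1 / x\<^sup>2) * g ?y + 1 / x * (g' ?y * (- (1 / x\<^sup>2)))) (at x)"
    using x0 by (auto intro!: derivative_eq_intros DERIV_chain2[where f = g and g = "\<lambda>t. 1 / t", OF g_deriv]
        simp: field_simps power2_eq_square)
  also have "- (1 / x\<^sup>2) * g ?y + 1 / x * (g' ?y * (- (1 / x\<^sup>2)))
      = (C - (of_real (a + b) * x + of_real (a - b)) * cauchy_transform x 1) / (1 - x\<^sup>2)"
  proof -
    have nz: "1 - x\<^sup>2 \<noteq> 0"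
      using x by (metis eq_iff_diff_eq_0 norm_one norm_power one_less_power pos2 less_irrefl)
    have "(x\<^sup>2 - 1) * (1 / x * g' ?y) = x\<^sup>2 * (?y * (1 - ?y\<^sup>2) * g' ?y)"
      using x0 by (simp add: field_simps power2_eq_square)
    also have "\<dots> = x\<^sup>2 * (C - C * g ?y + ?y\<^sup>2 * g ?y + of_real (b - a) * ?y * g ?y)"
      by (simp only: ode)
    also have "\<dots> = x\<^sup>2 * C - x\<^sup>2 * C * g ?y + g ?y + of_real (b - a) * x * g ?y"
      using x0 by (simp add: field_simps power2_eq_square)
    finally have main: "(x\<^sup>2 - 1) * (1 / x * g' ?y)
        = x\<^sup>2 * C - x\<^sup>2 * C * g ?y + g ?y + of_real (b - a) * x * g ?y" .
    have "(1 - x\<^sup>2) * (- (1 / x\<^sup>2) * g ?y + 1 / x * (g' ?y * (- (1 / x\<^sup>2))))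
        = (1 / x\<^sup>2) * ((x\<^sup>2 - 1) * g ?y + (x\<^sup>2 - 1) * (1 / x * g' ?y))"
      using x0 by (simp add: field_simps power2_eq_square)
    also have "\<dots> = C - (of_real (a + b) * x + of_real (a - b)) * (1 / x * g ?y)"
      unfolding main using x0 by (simp add: C_def field_simps power2_eq_square)
    finally have "(1 - x\<^sup>2) * (- (1 / x\<^sup>2) * g ?y + 1 / x * (g' ?y * (- (1 / x\<^sup>2))))
        = C - (of_real (a + b) * x + of_real (a - b)) * (1 / x * g ?y)"
      .
    then show ?thesis
      unfolding cauchy_eq[OF x] using nz by (simp add: nonzero_eq_divide_eq mult.commute)
  qed
  finally show ?thesis
    unfolding C_def
  proof (rule has_field_derivative_transform_within_open[of _ _ _ "- cball 0 1"])
    show "x \<in> - cball 0 1" using x by simp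
  qed (auto simp: cauchy_eq)
qed

end

section \<open>Branches of the inverse of a polynomial\<close>

lemma finite_separating_radius:
  fixes R :: "'a::metric_space set"
  assumes "finite R" and e: "\<And>x. x \<in> R \<Longrightarrow> e x > 0"
  shows "\<exists>s>0. (\<forall>x\<in>R. s \<le> e x) \<and> (\<forall>x\<in>R. \<forall>y\<in>R. x \<noteq> y \<longrightarrow> ball x s \<inter> ball y s = {})"
proof -
  have "\<exists>d>0. \<forall>y\<in>R. y \<noteq> x \<longrightarrow> d \<le> dist x y" for x
    using finite_set_avoid[OF \<open>finite R\<close>] by blast
  then obtain d where d: "\<And>x. d x > 0" "\<And>x y. y \<in> R \<Longrightarrow> y \<noteq> x \<Longrightarrow> d x \<le> dist x y" by metis
  define M where "M = insert 1 ((\<lambda>x. min (e x) (d x / 2)) ` R)"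
  have "finite M" using \<open>finite R\<close> by (simp add: M_def)
  have le: "Min M \<le> min (e x) (d x / 2)" if "x \<in> R" for x
    using that by (intro Min_le \<open>finite M\<close>) (auto simp: M_def)
  show ?thesis
  proof (intro exI conjI ballI impI)
    show "Min M > 0" using \<open>finite R\<close> e d(1) by (auto simp: M_def)
    show "Min M \<le> e x" if "x \<in> R" for x using le[OF that] by simp
    fix x y assume xy: "x \<in> R" "y \<in> R" "x \<noteq> y"
    have "2 * Min M \<le> dist x y"
      using le[OF xy(1)] d(2)[OF xy(2), of x] xy(3) by auto
    then show "ball x (Min M) \<inter> ball y (Min M) = {}" by (rule disjoint_ballI[OF order_trans[rotated]]) simp
  qed
qed

text \<open>Near each of the points over \<open>z\<close> the polynomial is injective. Any nearby value therefore has at least as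
many preimages close to these points as \<open>z\<close> has; since the number of preimages is always the degree, there
are no others.\<close>

lemma covering_space_poly:
  fixes f :: "complex poly"
  assumes deg: "degree f > 0" and "open S"
    and noncritical: "\<And>x. poly f x \<in> S \<Longrightarrow> poly (pderiv f) x \<noteq> 0"
  shows "covering_space (poly f -` S) (poly f) S"
proof
  show "continuous_on (poly f -` S) (poly f)" by (intro continuous_intros)
  have fin: "finite {x. poly f x = z}" and card: "card {x. poly f x = z} = degree f" if "z \<in> S" for z
    by (rule finite_simple_fibre[OF deg] card_simple_fibre[OF deg]; use that noncritical in blast)+
  show "poly f ` (poly f -` S) = S"
  proof safe
    fix z assume "z \<in> S"
    with card[OF this] deg have "{x. poly f x = z} \<noteq> {}" by (metis card.empty less_irrefl)
    then show "z \<in> poly f ` (poly f -` S)" using \<open>z \<in> S\<close> by auto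
  qed
  fix z assume z: "z \<in> S"
  let ?R = "{x. poly f x = z}"
  have "\<exists>r>0. inj_on (poly f) (ball x r)" if "x \<in> ?R" for x
  proof -
    have "deriv (poly f) x \<noteq> 0"
      using noncritical[of x] that z by (simp add: DERIV_imp_deriv[OF poly_DERIV])
    moreover have "poly f holomorphic_on UNIV" by (intro holomorphic_intros)
    ultimately show ?thesis
      by (metis UNIV_I has_complex_derivative_locally_invertible open_UNIV)
  qed
  then obtain r where r: "\<And>x. x \<in> ?R \<Longrightarrow> r x > 0 \<and> inj_on (poly f) (ball x (r x))" by metis
  have "\<exists>s>0. (\<forall>x\<in>?R. s \<le> r x) \<and> (\<forall>x\<in>?R. \<forall>y\<in>?R. x \<noteq> y \<longrightarrow> ball x s \<inter> ball y s = {})"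
    by (rule finite_separating_radius[OF fin[OF z]]) (use r in blast)
  then obtain s where s: "s > 0" "\<And>x. x \<in> ?R \<Longrightarrow> s \<le> r x"
    and disj: "\<And>x y u. x \<in> ?R \<Longrightarrow> y \<in> ?R \<Longrightarrow> u \<in> ball x s \<Longrightarrow> u \<in> ball y s \<Longrightarrow> x = y"
    by blast
  have inj: "inj_on (poly f) (ball x s)" if "x \<in> ?R" for x
    using r[OF that] s(2)[OF that] by (meson inj_on_subset subset_ball)
  have open_image: "open (poly f ` ball x s)" if "x \<in> ?R" for x
    using invariance_of_domain[OF _ open_ball inj[OF that]] by (simp add: continuous_intros)
  define T where "T = S \<inter> (\<Inter>x\<in>?R. poly f ` ball x s)"
  have "open T"
    unfolding T_def using \<open>open S\<close> fin[OF z] open_image by (intro open_Int open_INT) auto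
  have "z \<in> T" using z s(1) by (force simp: T_def)
  let ?V = "(\<lambda>x. ball x s \<inter> poly f -` T) ` ?R"
  have open_V: "open (ball x s \<inter> poly f -` T)" for x
    by (intro open_Int open_ball continuous_open_vimage \<open>open T\<close>) (simp add: continuous_intros)
  have "poly f -` T \<subseteq> \<Union>?V"
  proof
    fix y assume y: "y \<in> poly f -` T"
    then have "\<forall>x\<in>?R. \<exists>u\<in>ball x s. poly f u = poly f y" by (force simp: T_def)
    then obtain u where u: "\<And>x. x \<in> ?R \<Longrightarrow> u x \<in> ball x s \<and> poly f (u x) = poly f y" by metis
    have "inj_on u ?R" using u disj by (metis (no_types, lifting) inj_onI)
    moreover have "u ` ?R \<subseteq> {x. poly f x = poly f y}" using u by auto
    moreover have "poly f y \<in> S" using y by (auto simp: T_def)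
    ultimately have "u ` ?R = {x. poly f x = poly f y}"
      using card[OF z] card fin by (intro card_subset_eq) (auto simp: card_image)
    then have "y \<in> u ` ?R" by simp
    then obtain x where "x \<in> ?R" "u x = y" by blast
    with u y show "y \<in> \<Union>?V" by auto
  qed
  moreover have "T \<subseteq> S" by (auto simp: T_def)
  ultimately have "\<Union>?V = poly f -` S \<inter> poly f -` T" by auto
  moreover have "openin (top_of_set (poly f -` S)) u" if "u \<in> ?V" for u
    using that open_V \<open>T \<subseteq> S\<close> by (auto intro!: open_subset)
  moreover have "pairwise disjnt ?V"
  proof (rule pairwise_imageI)
    fix x y assume "x \<in> ?R" "y \<in> ?R" "x \<noteq> y"
    with disj[of x y] show "disjnt (ball x s \<inter> poly f -` T) (ball y s \<inter> poly f -` T)"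
      unfolding disjnt_def by blast
  qed
  moreover have "\<exists>q. homeomorphism u T (poly f) q" if u: "u \<in> ?V" for u
  proof -
    obtain x where x: "x \<in> ?R" "u = ball x s \<inter> poly f -` T" using u by blast
    have inj_u: "inj_on (poly f) u"
      using inj[OF x(1)] x(2) by (auto intro: inj_on_subset)
    have "T \<subseteq> poly f ` ball x s" using x(1) unfolding T_def by blast
    then have image: "poly f ` u = T" unfolding x(2) by blast
    have "open u" unfolding x(2) by (rule open_V)
    have "continuous_on u (poly f)" by (intro continuous_intros)
    from invariance_of_domain_homeomorphism[OF \<open>open u\<close> this order_refl inj_u]
    show ?thesis unfolding image by blast
  qed
  ultimately show "\<exists>T. z \<in> T \<and> openin (top_of_set S) T \<and>
      (\<exists>v. \<Union> v = poly f -` S \<inter> poly f -` T \<and> (\<forall>u\<in>v. openin (top_of_set (poly f -` S)) u) \<and>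
           pairwise disjnt v \<and> (\<forall>u\<in>v. \<exists>q. homeomorphism u T (poly f) q))"
    using \<open>z \<in> T\<close> \<open>open T\<close> \<open>T \<subseteq> S\<close>
    by (intro exI[of _ T] conjI exI[of _ ?V] ballI) (simp_all add: open_subset)
qed

text \<open>Lift the identity of the convex, hence simply connected, set \<open>S\<close> through the covering, starting at each point
over \<open>z0\<close>. Different lifts never meet, so by counting they exhaust every fibre.\<close>

lemma holomorphic_inverse_branches:
  fixes f :: "complex poly"
  assumes deg: "degree f > 0" and S: "open S" "convex S" "z0 \<in> S"
    and noncritical: "\<And>x. poly f x \<in> S \<Longrightarrow> poly (pderiv f) x \<noteq> 0"
  obtains g where "\<And>x. poly f x = z0 \<Longrightarrow> g x holomorphic_on S"
    and "\<And>z. z \<in> S \<Longrightarrow> bij_betw (\<lambda>x. g x z) {x. poly f x = z0} {y. poly f y = z}"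
proof -
  let ?C = "poly f -` S" and ?R = "{x. poly f x = z0}"
  have cov: "covering_space ?C (poly f) S"
    by (rule covering_space_poly[OF deg S(1) noncritical])
  have fin: "finite {x. poly f x = z}" and card: "card {x. poly f x = z} = degree f" if "z \<in> S" for z
    by (rule finite_simple_fibre[OF deg] card_simple_fibre[OF deg]; use that noncritical in blast)+
  have "\<exists>g. continuous_on S g \<and> g \<in> S \<rightarrow> ?C \<and> g z0 = x \<and> (\<forall>z\<in>S. poly f (g z) = z)"
    if "x \<in> ?R" for x
    by (rule covering_space_lift_strong[OF cov, of x z0 S "\<lambda>z. z"])
       (use that S in \<open>auto intro: convex_imp_simply_connected convex_imp_locally_path_connected\<close>)
  then obtain g where g: "\<And>x. x \<in> ?R \<Longrightarrow> continuous_on S (g x) \<and> g x \<in> S \<rightarrow> ?C \<and> g x z0 = x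
      \<and> (\<forall>z\<in>S. poly f (g x z) = z)" by metis
  have hol: "g x holomorphic_on S" if "x \<in> ?R" for x
  proof (rule covering_space_lift_is_holomorphic[OF cov])
    show "open ?C" using S(1) by (intro continuous_open_vimage) (auto intro!: continuous_intros)
    show "poly f holomorphic_on ?C" by (intro holomorphic_intros)
    show "(\<lambda>z. z) holomorphic_on S" by (intro holomorphic_intros)
  qed (use g[OF that] in auto)
  have inj: "x = y" if "x \<in> ?R" "y \<in> ?R" "z \<in> S" "g x z = g y z" for x y z
  proof -
    have "g x z0 = g y z0"
      by (rule covering_space_lift_unique[OF cov, of "g x" z "g y" S "\<lambda>z. z"])
         (use that g[of x] g[of y] S in \<open>auto intro: convex_connected continuous_intros\<close>)
    then show ?thesis using g that by metis
  qed
  have "bij_betw (\<lambda>x. g x z) ?R {y. poly f y = z}" if z: "z \<in> S" for z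
  proof -
    have "inj_on (\<lambda>x. g x z) ?R" using inj z by (auto intro: inj_onI)
    moreover have "(\<lambda>x. g x z) ` ?R \<subseteq> {y. poly f y = z}" using g z by blast
    ultimately show ?thesis
      unfolding bij_betw_def using card[OF z] card[OF S(3)] fin[OF z]
      by (metis (no_types, lifting) card_image card_subset_eq)
  qed
  then show ?thesis using that hol by auto
qed

section \<open>Decay of one branch at the origin\<close>

text \<open>Choose \<open>p > 0\<close> with \<open>q \<le> p < s\<close>. Integrating the bound on \<open>\<gamma>'\<close> from \<open>r\<close> to \<open>r0\<close> gives \<open>\<gamma> r = O(r powr - p)\<close>,
and \<open>u r = O(r powr s)\<close> more than compensates this. The detour through \<open>p\<close> avoids a separate treatment of
\<open>q = 0\<close>, where \<open>\<gamma>\<close> may grow logarithmically, and of \<open>q < 0\<close>.\<close>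

lemma primitive_decay:
  fixes \<gamma> \<gamma>' u :: "real \<Rightarrow> complex"
  assumes r0: "0 < r0" "r0 \<le> 1" and qs: "q < s" "0 < s"
    and deriv: "\<And>r. 0 < r \<Longrightarrow> r \<le> r0 \<Longrightarrow> (\<gamma> has_vector_derivative \<gamma>' r) (at r)"
    and bound': "\<And>r. 0 < r \<Longrightarrow> r \<le> r0 \<Longrightarrow> norm (\<gamma>' r) \<le> B * r powr (- 1 - q)"
    and bound_u: "\<And>r. 0 < r \<Longrightarrow> r \<le> r0 \<Longrightarrow> norm (u r) \<le> A * r powr s"
  shows "((\<lambda>r. u r * (\<gamma> r + c)) \<longlongrightarrow> 0) (at_right 0)"
proof -
  define p where "p = max q (s / 2)"
  have p: "0 < p" "q \<le> p" "p < s" using qs by (auto simp: p_def)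
  have "0 \<le> B * r0 powr (- 1 - q)" using bound'[of r0] r0 norm_ge_zero order.trans by blast
  then have B: "B \<ge> 0" using r0 by (simp add: zero_le_mult_iff)
  have "0 \<le> A * r0 powr s" using bound_u[of r0] r0 norm_ge_zero order.trans by blast
  then have A: "A \<ge> 0" using r0 by (simp add: zero_le_mult_iff)
  define M where "M = norm (\<gamma> r0 + c)"
  have growth: "norm (\<gamma> r + c) \<le> M + B / p * r powr (- p)" if r: "0 < r" "r < r0" for r
  proof -
    have "norm (\<gamma> r0 - \<gamma> r) \<le> - (B / p) * r0 powr (- p) - - (B / p) * r powr (- p)"
    proof (rule differentiable_bound_general[OF r(2)])
      show "continuous_on {r..r0} \<gamma>"
      proof (intro continuous_at_imp_continuous_on ballI)
        fix x assume "x \<in> {r..r0}"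
        then have "(\<gamma> has_vector_derivative \<gamma>' x) (at x)" using deriv r by auto
        then show "isCont \<gamma> x" by (rule has_vector_derivative_continuous)
      qed
      show "continuous_on {r..r0} (\<lambda>x. - (B / p) * x powr (- p))"
        using r by (intro continuous_intros) auto
      fix x assume x: "r < x" "x < r0"
      show "(\<gamma> has_vector_derivative \<gamma>' x) (at x)" using deriv x r by auto
      show "((\<lambda>x. - (B / p) * x powr (- p)) has_vector_derivative B * x powr (- 1 - p)) (at x)"
        unfolding has_real_derivative_iff_has_vector_derivative[symmetric]
        using x r p by (auto intro!: derivative_eq_intros simp: minus_diff_commute)
      have "norm (\<gamma>' x) \<le> B * x powr (- 1 - q)" using bound' x r by auto
      also have "x powr (- 1 - q) \<le> x powr (- 1 - p)"
        using x r r0 p by (intro powr_mono') auto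
      finally show "norm (\<gamma>' x) \<le> B * x powr (- 1 - p)" using B by (simp add: mult_left_mono)
    qed
    also have "\<dots> \<le> B / p * r powr (- p)" using B p by simp
    finally have "norm (\<gamma> r0 - \<gamma> r) \<le> B / p * r powr (- p)" .
    moreover have "norm (\<gamma> r + c) \<le> norm (\<gamma> r0 + c) + norm (\<gamma> r0 - \<gamma> r)"
      using norm_triangle_ineq4[of "\<gamma> r0 + c" "\<gamma> r0 - \<gamma> r"] by (simp add: add.commute[of c])
    ultimately show ?thesis by (simp add: M_def)
  qed
  have le: "norm (u r * (\<gamma> r + c)) \<le> A * (M * r powr s + B / p * r powr (s - p))"
    if r: "0 < r" "r < r0" for r
  proof -
    have "norm (u r * (\<gamma> r + c)) \<le> (A * r powr s) * (M + B / p * r powr (- p))"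
      unfolding norm_mult using r A by (intro mult_mono bound_u growth) auto
    also have "\<dots> = A * (M * r powr s + B / p * (r powr s * r powr (- p)))"
      by (simp add: algebra_simps)
    finally show ?thesis by (simp add: powr_add[symmetric])
  qed
  have "((\<lambda>r. A * (M * r powr s + B / p * r powr (s - p))) \<longlongrightarrow> A * (M * 0 powr s + B / p * 0 powr (s - p))) (at_right 0)"
    using qs p by (intro tendsto_intros tendsto_powr') (auto simp: eventually_at_right_less eventually_at_right_field intro!: exI[of _ 1])
  then have "((\<lambda>r. A * (M * r powr s + B / p * r powr (s - p))) \<longlongrightarrow> 0) (at_right 0)" by simp
  then show ?thesis
  proof (rule Lim_null_comparison[rotated])
    show "\<forall>\<^sub>F r in at_right 0. norm (u r * (\<gamma> r + c)) \<le> A * (M * r powr s + B / p * r powr (s - p))"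
      using le r0 by (auto simp: eventually_at_right_field intro!: exI[of _ r0])
  qed
qed

lemma isCont_positive_two_sided_bound:
  fixes h :: "complex \<Rightarrow> real"
  assumes "isCont h \<rho>" "h \<rho> > 0"
  obtains \<epsilon> A where "\<epsilon> > 0" "A > 0" "\<And>x. dist x \<rho> < \<epsilon> \<Longrightarrow> 0 < h x \<and> h x \<le> A \<and> 1 / h x \<le> A"
proof -
  have lim: "(h \<longlongrightarrow> h \<rho>) (nhds \<rho>)" using assms(1) by (simp add: isCont_def tendsto_at_iff_tendsto_nhds)
  have "\<forall>\<^sub>F x in nhds \<rho>. h x < 2 * h \<rho> \<and> h x > h \<rho> / 2"
    using assms(2) by (intro eventually_conj order_tendstoD[OF lim]) auto
  then obtain \<epsilon> where eps: "\<epsilon> > 0" "\<And>x. dist x \<rho> < \<epsilon> \<Longrightarrow> h x < 2 * h \<rho> \<and> h x > h \<rho> / 2"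
    by (auto simp: eventually_nhds_metric)
  show ?thesis
  proof (rule that[of \<epsilon> "max (2 * h \<rho>) (2 / h \<rho>)"])
    fix x assume "dist x \<rho> < \<epsilon>"
    from eps(2)[OF this] assms(2) have "0 < h x" "h x \<le> 2 * h \<rho>" "1 / h x \<le> 2 / h \<rho>"
      by (auto simp: field_simps)
    then show "0 < h x \<and> h x \<le> max (2 * h \<rho>) (2 / h \<rho>) \<and> 1 / h x \<le> max (2 * h \<rho>) (2 / h \<rho>)" by auto
  qed (use eps assms(2) in auto)
qed

lemma powr_comparable:
  fixes x y A p :: real
  assumes "0 < x" "0 < y" "x \<le> A * y" "y \<le> A * x"
  shows "x powr p \<le> A powr \<bar>p\<bar> * y powr p"
proof -
  have A: "A > 0" using assms by (metis less_le_trans zero_less_mult_pos2)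
  show ?thesis
  proof (cases "p \<ge> 0")
    case True
    then have "x powr p \<le> (A * y) powr p" using assms by (intro powr_mono2) auto
    then show ?thesis using True A assms by (simp add: powr_mult)
  next
    case False
    have "y / A \<le> x" using assms A by (simp add: field_simps)
    then have "x powr p \<le> (y / A) powr p" using False assms A by (intro powr_mono2') auto
    then show ?thesis using False A assms by (simp add: powr_divide powr_minus_divide field_simps)
  qed
qed

text \<open>Here \<open>k\<close> is the multiplicity of \<open>\<rho>\<close>. Of the three bounds, the last says that \<open>f / f'\<close> has a zero at \<open>\<rho>\<close>.\<close>

lemma poly_near_root:
  fixes f :: "complex poly"
  assumes "f \<noteq> 0" "poly f \<rho> = 0"
  obtains \<epsilon> A k where "\<epsilon> > 0" "A > 0" "k > 0"
    "\<And>x. dist x \<rho> < \<epsilon> \<Longrightarrow> x \<noteq> \<rho> \<Longrightarrow> cmod (poly f x) \<le> A * cmod (x - \<rho>) ^ k"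
    "\<And>x. dist x \<rho> < \<epsilon> \<Longrightarrow> x \<noteq> \<rho> \<Longrightarrow> cmod (x - \<rho>) ^ k \<le> A * cmod (poly f x)"
    "\<And>x. dist x \<rho> < \<epsilon> \<Longrightarrow> x \<noteq> \<rho> \<Longrightarrow> cmod (poly f x / poly (pderiv f) x) \<le> A * cmod (x - \<rho>)"
proof -
  define k where "k = order \<rho> f"
  have k: "k > 0" using assms by (simp add: k_def order_gt_0_iff)
  obtain h where f: "f = [:-\<rho>, 1:] ^ k * h" and "\<not> [:-\<rho>, 1:] dvd h"
    using order_decomp[OF assms(1), of \<rho>] by (auto simp: k_def)
  then have h: "poly h \<rho> \<noteq> 0" by (simp add: poly_eq_0_iff_dvd)
  define h1 where "h1 = smult (of_nat k) h + [:-\<rho>, 1:] * pderiv h"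
  have h1: "poly h1 \<rho> \<noteq> 0" using h k by (simp add: h1_def)
  have "pderiv f = [:-\<rho>, 1:] ^ (k - 1) * h1"
  proof -
    obtain n where n: "k = Suc n" using k gr0_implies_Suc by blast
    have "pderiv ([:-\<rho>, 1:] ^ Suc n) = smult (of_nat (Suc n)) ([:-\<rho>, 1:] ^ n)"
      by (simp add: pderiv_power_Suc pderiv_pCons del: power_Suc)
    then show ?thesis
      unfolding f h1_def n pderiv_mult by (simp add: algebra_simps del: mult_pCons_left mult_pCons_right of_nat_Suc)
  qed
  then have f': "poly (pderiv f) x = (x - \<rho>) ^ (k - 1) * poly h1 x" for x by simp
  have fx: "poly f x = (x - \<rho>) ^ k * poly h x" for x by (simp add: f)
  have "isCont (\<lambda>x. cmod (poly h x)) \<rho>" by (intro continuous_intros)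
  then obtain \<epsilon>1 A1 where 1: "\<epsilon>1 > 0" "A1 > 0" "\<And>x. dist x \<rho> < \<epsilon>1 \<Longrightarrow> 0 < cmod (poly h x) \<and> cmod (poly h x) \<le> A1 \<and> 1 / cmod (poly h x) \<le> A1"
    using isCont_positive_two_sided_bound[where h = "\<lambda>x. cmod (poly h x)" and \<rho> = \<rho>] h by (metis zero_less_norm_iff)
  have "isCont (\<lambda>x. cmod (poly h1 x)) \<rho>" by (intro continuous_intros)
  then obtain \<epsilon>2 A2 where 2: "\<epsilon>2 > 0" "A2 > 0" "\<And>x. dist x \<rho> < \<epsilon>2 \<Longrightarrow> 0 < cmod (poly h1 x) \<and> cmod (poly h1 x) \<le> A2 \<and> 1 / cmod (poly h1 x) \<le> A2"
    using isCont_positive_two_sided_bound[where h = "\<lambda>x. cmod (poly h1 x)" and \<rho> = \<rho>] h1 by (metis zero_less_norm_iff)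
  define A where "A = max A1 (A1 * A2)"
  show ?thesis
  proof (rule that[of "min \<epsilon>1 \<epsilon>2" A k])
    fix x assume x: "dist x \<rho> < min \<epsilon>1 \<epsilon>2" "x \<noteq> \<rho>"
    let ?d = "cmod (x - \<rho>)"
    have d: "?d > 0" using x by simp
    note b1 = 1(3)[of x] and b2 = 2(3)[of x]
    show "cmod (poly f x) \<le> A * ?d ^ k"
      using b1 x d by (simp add: fx norm_mult norm_power A_def mult.commute mult_left_mono le_max_iff_disj)
    have "?d ^ k = cmod (poly f x) * (1 / cmod (poly h x))"
      using b1 x by (simp add: fx norm_mult norm_power)
    also have "\<dots> \<le> cmod (poly f x) * A"
      using b1 x by (intro mult_left_mono) (auto simp: A_def)
    finally show "?d ^ k \<le> A * cmod (poly f x)" by (simp add: mult.commute)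
    have "?d ^ k = ?d * ?d ^ (k - 1)" using k by (cases k) auto
    then have "cmod (poly f x / poly (pderiv f) x) = ?d * (cmod (poly h x) * (1 / cmod (poly h1 x)))"
      using d by (simp add: fx f' norm_mult norm_divide norm_power)
    also have "\<dots> \<le> ?d * (A1 * A2)"
      using b1 b2 x 1(2) by (intro mult_left_mono mult_mono) auto
    also have "\<dots> \<le> ?d * A" by (intro mult_left_mono) (auto simp: A_def)
    finally show "cmod (poly f x / poly (pderiv f) x) \<le> A * ?d" by (simp add: mult.commute)
  qed (use 1 2 k in \<open>auto simp: A_def\<close>)
qed

text \<open>The exponent \<open>e\<close> is \<open>a\<close> at \<open>1\<close>, \<open>b\<close> at \<open>-1\<close>, and \<open>0\<close> elsewhere. The three cases are treated alike: then the
estimates near a root of \<open>f\<close> do not depend on whether this root is one of the singular points.\<close>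

lemma jacobi_weight_near_point:
  fixes a b :: real and \<rho> :: complex
  assumes ab: "a > -1" "b > -1"
  obtains \<epsilon> A e where "\<epsilon> > 0" "A > 0" "e > -1"
    "\<And>x. dist x \<rho> < \<epsilon> \<Longrightarrow> x \<noteq> \<rho> \<Longrightarrow>
       cmod (x - 1) powr a * cmod (x + 1) powr b \<le> A * cmod (x - \<rho>) powr e"
    "\<And>x. dist x \<rho> < \<epsilon> \<Longrightarrow> x \<noteq> \<rho> \<Longrightarrow>
       1 / (cmod (x - 1) powr a * cmod (x + 1) powr b) \<le> A * cmod (x - \<rho>) powr - e"
    "\<And>x. dist x \<rho> < \<epsilon> \<Longrightarrow> x \<noteq> \<rho> \<Longrightarrow> 1 / cmod (1 - x\<^sup>2) \<le> A / cmod (x - \<rho>)"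
proof -
  \<comment> \<open>split off the singular factor: the weight is \<open>|x - \<rho>| powr e * h x\<close>, and \<open>|1 - x\<^sup>2|\<close> is at
      least \<open>|x - \<rho>| * g x\<close>, with \<open>g\<close> and \<open>h\<close> continuous and positive at \<open>\<rho>\<close>\<close>
  note obtained = that
  have core: thesis
    if e: "e > -1" and h: "isCont h \<rho>" "h \<rho> > 0" and g: "isCont g \<rho>" "g \<rho> > 0"
      and wh: "\<And>x. x \<noteq> \<rho> \<Longrightarrow> cmod (x - 1) powr a * cmod (x + 1) powr b = cmod (x - \<rho>) powr e * h x"
      and xg: "\<And>x. x \<noteq> \<rho> \<Longrightarrow> dist x \<rho> < 1 \<Longrightarrow> cmod (1 - x\<^sup>2) \<ge> cmod (x - \<rho>) * g x"
    for e h g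
  proof -
    obtain \<epsilon>1 A1 where 1: "\<epsilon>1 > 0" "A1 > 0" "\<And>x. dist x \<rho> < \<epsilon>1 \<Longrightarrow> 0 < h x \<and> h x \<le> A1 \<and> 1 / h x \<le> A1"
      using isCont_positive_two_sided_bound[OF h] by metis
    obtain \<epsilon>2 A2 where 2: "\<epsilon>2 > 0" "A2 > 0" "\<And>x. dist x \<rho> < \<epsilon>2 \<Longrightarrow> 0 < g x \<and> g x \<le> A2 \<and> 1 / g x \<le> A2"
      using isCont_positive_two_sided_bound[OF g] by metis
    show thesis
    proof (rule obtained[of "min 1 (min \<epsilon>1 \<epsilon>2)" "max A1 A2" e])
      fix x assume x: "dist x \<rho> < min 1 (min \<epsilon>1 \<epsilon>2)" "x \<noteq> \<rho>"
      let ?d = "cmod (x - \<rho>)"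
      have d: "?d > 0" using x by simp
      have b1: "0 < h x" "h x \<le> max A1 A2" "1 / h x \<le> max A1 A2" using 1(3)[of x] x by auto
      have b2: "0 < g x" "1 / g x \<le> max A1 A2" using 2(3)[of x] x by auto
      show "cmod (x - 1) powr a * cmod (x + 1) powr b \<le> max A1 A2 * ?d powr e"
        unfolding wh[OF x(2)] using b1(2) by (subst mult.commute) (rule mult_right_mono, auto)
      have "1 / (?d powr e * h x) = ?d powr - e * (1 / h x)"
        by (simp add: powr_minus_divide)
      also have "\<dots> \<le> ?d powr - e * max A1 A2" using b1(3) by (intro mult_left_mono) auto
      finally show "1 / (cmod (x - 1) powr a * cmod (x + 1) powr b) \<le> max A1 A2 * ?d powr - e"
        unfolding wh[OF x(2)] by (simp add: mult.commute)
      have "?d * g x > 0" "?d * g x \<le> cmod (1 - x\<^sup>2)" using xg[of x] x d b2 by auto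
      then have "1 / cmod (1 - x\<^sup>2) \<le> 1 / (?d * g x)" by (intro frac_le) auto
      also have "\<dots> = 1 / g x / ?d" by simp
      also have "\<dots> \<le> max A1 A2 / ?d" using b2(2) d by (intro divide_right_mono) auto
      finally show "1 / cmod (1 - x\<^sup>2) \<le> max A1 A2 / ?d" .
    qed (use 1 2 e in auto)
  qed
  have factor: "cmod (1 - x\<^sup>2) = cmod (x - 1) * cmod (x + 1)" for x :: complex
    by (simp add: norm_mult[symmetric] norm_minus_commute[of 1] power2_eq_square algebra_simps)
  consider "\<rho> = 1" | "\<rho> = -1" | "\<rho> \<noteq> 1" "\<rho> \<noteq> -1" by blast
  then show thesis
  proof cases
    case 1
    then show thesis
      by (intro core[of a "\<lambda>x. cmod (x + 1) powr b" "\<lambda>x. cmod (x + 1)"])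
         (use ab in \<open>auto intro!: continuous_intros simp: factor\<close>)
  next
    case 2
    then show thesis
      by (intro core[of b "\<lambda>x. cmod (x - 1) powr a" "\<lambda>x. cmod (x - 1)"])
         (use ab in \<open>auto intro!: continuous_intros simp: factor\<close>)
  next
    case 3
    show thesis
    proof (rule core[of 0 "\<lambda>x. cmod (x - 1) powr a * cmod (x + 1) powr b" "\<lambda>x. cmod (1 - x\<^sup>2)"])
      fix x assume "x \<noteq> \<rho>" "dist x \<rho> < 1"
      then show "cmod (x - \<rho>) * cmod (1 - x\<^sup>2) \<le> cmod (1 - x\<^sup>2)"
        by (intro mult_left_le_one_le) (auto simp: dist_norm)
    qed (use 3 in \<open>auto intro!: continuous_intros simp: factor add_eq_0_iff2\<close>)
  qed
qed

text \<open>Up to the leading coefficient, \<open>cmod (poly f x)\<close> is the product of the distances from \<open>x\<close> to the roots; if all of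
them are at least \<open>\<epsilon>\<close>, it is bounded below.\<close>

lemma small_values_near_roots:
  fixes f :: "complex poly"
  assumes "f \<noteq> 0" "\<epsilon> > 0"
  obtains \<eta> where "\<eta> > 0" "\<And>x. cmod (poly f x) < \<eta> \<Longrightarrow> \<exists>\<rho>. poly f \<rho> = 0 \<and> dist x \<rho> < \<epsilon>"
proof -
  obtain root where f: "smult (lead_coeff f) (\<Prod>i<degree f. [:- root i, 1:]) = f"
    by (rule complex_poly_decompose')
  have eval: "poly f x = lead_coeff f * (\<Prod>i<degree f. x - root i)" for x
    by (subst f[symmetric]) (simp add: poly_prod)
  show ?thesis
  proof (rule that[of "cmod (lead_coeff f) * \<epsilon> ^ degree f"])
    show "cmod (lead_coeff f) * \<epsilon> ^ degree f > 0" using assms by simp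
    fix x assume small: "cmod (poly f x) < cmod (lead_coeff f) * \<epsilon> ^ degree f"
    show "\<exists>\<rho>. poly f \<rho> = 0 \<and> dist x \<rho> < \<epsilon>"
    proof (rule ccontr)
      assume far: "\<nexists>\<rho>. poly f \<rho> = 0 \<and> dist x \<rho> < \<epsilon>"
      have "cmod (x - root i) \<ge> \<epsilon>" if "i < degree f" for i
      proof -
        have "poly f (root i) = 0" unfolding eval using that by (auto intro!: prod_zero)
        then show ?thesis using far by (force simp: dist_norm)
      qed
      then have "(\<Prod>i<degree f. \<epsilon>) \<le> (\<Prod>i<degree f. cmod (x - root i))"
        using assms(2) by (intro prod_mono) auto
      then have "cmod (lead_coeff f) * \<epsilon> ^ degree f \<le> cmod (poly f x)"
        unfolding eval by (simp add: norm_mult prod_norm mult_left_mono)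
      with small show False by simp
    qed
  qed
qed

text \<open>A single radius and a single constant for all estimates at a root, so that the roots of \<open>f\<close> can be treated uniformly.\<close>

lemma polynomial_and_weight_near_root:
  fixes f :: "complex poly" and a b :: real
  assumes f: "f \<noteq> 0" "poly f \<rho> = 0" and ab: "a > -1" "b > -1"
  shows "\<exists>\<epsilon> A k e. \<epsilon> > 0 \<and> A > 0 \<and> k > (0::nat) \<and> e > -1 \<and> (\<forall>x. dist x \<rho> < \<epsilon> \<longrightarrow> x \<noteq> \<rho> \<longrightarrow>
     cmod (poly f x) \<le> A * cmod (x - \<rho>) ^ k \<and> cmod (x - \<rho>) ^ k \<le> A * cmod (poly f x) \<and>
     cmod (poly f x / poly (pderiv f) x) \<le> A * cmod (x - \<rho>) \<and>
     cmod (x - 1) powr a * cmod (x + 1) powr b \<le> A * cmod (x - \<rho>) powr e \<and>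
     1 / (cmod (x - 1) powr a * cmod (x + 1) powr b) \<le> A * cmod (x - \<rho>) powr - e \<and>
     1 / cmod (1 - x\<^sup>2) \<le> A / cmod (x - \<rho>))"
proof -
  obtain \<epsilon>1 A1 k where 1: "\<epsilon>1 > 0" "A1 > 0" "k > 0"
    "\<And>x. dist x \<rho> < \<epsilon>1 \<Longrightarrow> x \<noteq> \<rho> \<Longrightarrow> cmod (poly f x) \<le> A1 * cmod (x - \<rho>) ^ k"
    "\<And>x. dist x \<rho> < \<epsilon>1 \<Longrightarrow> x \<noteq> \<rho> \<Longrightarrow> cmod (x - \<rho>) ^ k \<le> A1 * cmod (poly f x)"
    "\<And>x. dist x \<rho> < \<epsilon>1 \<Longrightarrow> x \<noteq> \<rho> \<Longrightarrow> cmod (poly f x / poly (pderiv f) x) \<le> A1 * cmod (x - \<rho>)"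
    using poly_near_root[OF f] by blast
  obtain \<epsilon>2 A2 e where 2: "\<epsilon>2 > 0" "A2 > 0" "e > -1"
    "\<And>x. dist x \<rho> < \<epsilon>2 \<Longrightarrow> x \<noteq> \<rho> \<Longrightarrow>
       cmod (x - 1) powr a * cmod (x + 1) powr b \<le> A2 * cmod (x - \<rho>) powr e"
    "\<And>x. dist x \<rho> < \<epsilon>2 \<Longrightarrow> x \<noteq> \<rho> \<Longrightarrow>
       1 / (cmod (x - 1) powr a * cmod (x + 1) powr b) \<le> A2 * cmod (x - \<rho>) powr - e"
    "\<And>x. dist x \<rho> < \<epsilon>2 \<Longrightarrow> x \<noteq> \<rho> \<Longrightarrow> 1 / cmod (1 - x\<^sup>2) \<le> A2 / cmod (x - \<rho>)"
    using jacobi_weight_near_point[OF ab] by blast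
  define A where "A = max A1 A2"
  have weaken: "X \<le> A * Y" if "X \<le> A1 * Y \<or> X \<le> A2 * Y" "Y \<ge> 0" for X Y
  proof -
    have "A1 * Y \<le> A * Y" "A2 * Y \<le> A * Y"
      using that(2) by (auto simp: A_def intro: mult_right_mono)
    then show ?thesis using that(1) by linarith
  qed
  show ?thesis
  proof (intro exI conjI allI impI)
    fix x assume "dist x \<rho> < min \<epsilon>1 \<epsilon>2" "x \<noteq> \<rho>"
    then have x: "dist x \<rho> < \<epsilon>1" "dist x \<rho> < \<epsilon>2" "x \<noteq> \<rho>" by auto
    show "cmod (poly f x) \<le> A * cmod (x - \<rho>) ^ k" by (rule weaken) (use 1(4) x in auto)
    show "cmod (x - \<rho>) ^ k \<le> A * cmod (poly f x)" by (rule weaken) (use 1(5) x in auto)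
    show "cmod (poly f x / poly (pderiv f) x) \<le> A * cmod (x - \<rho>)"
      by (rule weaken) (use 1(6) x in auto)
    show "cmod (x - 1) powr a * cmod (x + 1) powr b \<le> A * cmod (x - \<rho>) powr e"
      by (rule weaken) (use 2(4) x in auto)
    show "1 / (cmod (x - 1) powr a * cmod (x + 1) powr b) \<le> A * cmod (x - \<rho>) powr - e"
      by (rule weaken) (use 2(5) x in auto)
    have "1 / cmod (1 - x\<^sup>2) \<le> A * (1 / cmod (x - \<rho>))"
      by (rule weaken) (use 2(6) x in auto)
    then show "1 / cmod (1 - x\<^sup>2) \<le> A / cmod (x - \<rho>)" by simp
  qed (use 1 2 in \<open>auto simp: A_def\<close>)
qed

text \<open>For small \<open>r\<close> the point \<open>t r\<close> lies in one of several disjoint balls around the roots of \<open>f\<close>. By connectedness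
it remains in the same ball. The radius \<open>e \<rho>\<close> may depend on the root, to fit the local estimates.\<close>

lemma inverse_branch_approaches_root:
  fixes f :: "complex poly" and t :: "real \<Rightarrow> complex"
  assumes "f \<noteq> 0" and e: "\<And>\<rho>. poly f \<rho> = 0 \<Longrightarrow> e \<rho> > 0"
    and cont: "continuous_on {0<..} t" and ft: "\<And>r. r > 0 \<Longrightarrow> poly f (t r) = of_real r"
  obtains \<rho> \<eta> where "poly f \<rho> = 0" "\<eta> > 0" "\<And>r. 0 < r \<Longrightarrow> r < \<eta> \<Longrightarrow> dist (t r) \<rho> < e \<rho>"
proof -
  let ?Z = "{\<rho>. poly f \<rho> = 0}"
  have "\<exists>s>0. (\<forall>\<rho>\<in>?Z. s \<le> e \<rho>) \<and> (\<forall>x\<in>?Z. \<forall>y\<in>?Z. x \<noteq> y \<longrightarrow> ball x s \<inter> ball y s = {})"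
    by (rule finite_separating_radius) (use poly_roots_finite[OF \<open>f \<noteq> 0\<close>] e in auto)
  then obtain s where s: "s > 0" "\<And>\<rho>. \<rho> \<in> ?Z \<Longrightarrow> s \<le> e \<rho>"
    and disj: "\<And>x y. x \<in> ?Z \<Longrightarrow> y \<in> ?Z \<Longrightarrow> x \<noteq> y \<Longrightarrow> ball x s \<inter> ball y s = {}" by blast
  obtain \<eta> where \<eta>: "\<eta> > 0" "\<And>x. cmod (poly f x) < \<eta> \<Longrightarrow> \<exists>\<rho>. poly f \<rho> = 0 \<and> dist x \<rho> < s"
    using small_values_near_roots[OF \<open>f \<noteq> 0\<close> s(1)] by blast
  let ?T = "t ` {0<..<\<eta>}"
  have conn: "connected ?T"
    by (intro connected_continuous_image continuous_on_subset[OF cont]) auto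
  have cover: "\<exists>\<rho>\<in>?Z. x \<in> ball \<rho> s" if "x \<in> ?T" for x
    using that \<eta>(2)[of x] ft by (auto simp: dist_commute)
  have "t (\<eta> / 2) \<in> ?T" using \<eta>(1) by auto
  from cover[OF this] obtain \<rho> where \<rho>: "\<rho> \<in> ?Z" "t (\<eta> / 2) \<in> ball \<rho> s" by blast
  let ?B = "\<Union>\<sigma>\<in>?Z - {\<rho>}. ball \<sigma> s"
  have "ball \<rho> s \<inter> ?T = {} \<or> ?B \<inter> ?T = {}"
  proof (rule connectedD[OF conn])
    show "open ?B" by auto
    show "ball \<rho> s \<inter> ?B \<inter> ?T = {}" using disj[OF \<rho>(1)] by blast
    show "?T \<subseteq> ball \<rho> s \<union> ?B" using cover by blast
  qed auto
  then have "?B \<inter> ?T = {}" using \<rho>(2) \<open>t (\<eta> / 2) \<in> ?T\<close> by blast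
  then have near: "?T \<subseteq> ball \<rho> s" using cover by blast
  show ?thesis
  proof (rule that[of \<rho> \<eta>])
    fix r assume "0 < r" "r < \<eta>"
    then have "t r \<in> ?T" by auto
    then have "t r \<in> ball \<rho> s" using near by blast
    then show "dist (t r) \<rho> < e \<rho>" using s(2)[OF \<rho>(1)] by (simp add: dist_commute)
  qed (use \<rho> \<eta> in auto)
qed

text \<open>Here \<open>E = exp (a l1 + b l2)\<close> is the continued weight \<open>(t - 1)\<^sup>a (t + 1)\<^sup>b\<close>, and for
\<open>K = 1 + a + b\<close> the function \<open>E (G + c)\<close> is a solution of the differential equation of the Cauchy transform,
pulled back by the branch \<open>t\<close>. With \<open>\<rho>\<close> the limit of the
branch, \<open>k\<close> its multiplicity as a root, \<open>e\<close> the exponent of the weight there, and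
\<open>\<delta> = \<bar>t - \<rho>\<bar>\<close> of the order of \<open>r powr (1 / k)\<close>, the factor \<open>r E / f'(t)\<close> is \<open>O(\<delta> powr (1 + e))\<close>, and the derivative of
\<open>G\<close> is \<open>O(\<delta> powr - e / r)\<close>. As \<open>1 + e > 0\<close>, \<open>primitive_decay\<close> applies.\<close>

lemma branch_contribution_vanishes:
  fixes f :: "complex poly" and a b :: real and t l1 l2 G :: "complex \<Rightarrow> complex"
  assumes ab: "a > -1" "b > -1" and deg: "degree f > 0"
    and S: "open S" "\<And>r::real. r > 0 \<Longrightarrow> of_real r \<in> S"
    and t: "t holomorphic_on S" "\<And>z. z \<in> S \<Longrightarrow> poly f (t z) = z"
    and noncritical: "\<And>x. poly f x \<in> S \<Longrightarrow> poly (pderiv f) x \<noteq> 0"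
    and l1: "\<And>z. z \<in> S \<Longrightarrow> t z - 1 = exp (l1 z)" and l2: "\<And>z. z \<in> S \<Longrightarrow> t z + 1 = exp (l2 z)"
    and G: "\<And>z. z \<in> S \<Longrightarrow> (G has_field_derivative
          K * deriv t z / ((1 - (t z)\<^sup>2) * exp (of_real a * l1 z + of_real b * l2 z))) (at z)"
  shows "((\<lambda>r. of_real r / poly (pderiv f) (t (of_real r))
              * exp (of_real a * l1 (of_real r) + of_real b * l2 (of_real r)) * (G (of_real r) + c))
            \<longlongrightarrow> 0) (at_right 0)"
proof -
  let ?E = "\<lambda>z. exp (of_real a * l1 z + of_real b * l2 z)"
  have f0: "f \<noteq> 0" using deg by auto
  have norm_E: "cmod (?E z) = cmod (t z - 1) powr a * cmod (t z + 1) powr b" if "z \<in> S" for z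
    unfolding l1[OF that] l2[OF that]
    by (simp add: norm_exp_eq_Re exp_powr_real exp_add[symmetric] mult.commute)
  have deriv_t: "poly (pderiv f) (t z) * deriv t z = 1" if z: "z \<in> S" for z
  proof (rule DERIV_unique)
    have "(t has_field_derivative deriv t z) (at z)" using t(1) S(1) z by (rule holomorphic_derivI)
    then have "((\<lambda>z. poly f (t z)) has_field_derivative poly (pderiv f) (t z) * deriv t z) (at z)"
      by (rule DERIV_chain2[OF poly_DERIV])
    then show "((\<lambda>z. z) has_field_derivative poly (pderiv f) (t z) * deriv t z) (at z)"
      by (rule has_field_derivative_transform_within_open[OF _ S(1) z]) (use t(2) in auto)
  qed auto
  have "\<forall>\<rho>. \<exists>\<epsilon> A k e. poly f \<rho> = 0 \<longrightarrow> \<epsilon> > 0 \<and> A > 0 \<and> k > (0::nat) \<and> e > -1 \<and>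
     (\<forall>x. dist x \<rho> < \<epsilon> \<longrightarrow> x \<noteq> \<rho> \<longrightarrow>
     cmod (poly f x) \<le> A * cmod (x - \<rho>) ^ k \<and> cmod (x - \<rho>) ^ k \<le> A * cmod (poly f x) \<and>
     cmod (poly f x / poly (pderiv f) x) \<le> A * cmod (x - \<rho>) \<and>
     cmod (x - 1) powr a * cmod (x + 1) powr b \<le> A * cmod (x - \<rho>) powr e \<and>
     1 / (cmod (x - 1) powr a * cmod (x + 1) powr b) \<le> A * cmod (x - \<rho>) powr - e \<and>
     1 / cmod (1 - x\<^sup>2) \<le> A / cmod (x - \<rho>))"
    using polynomial_and_weight_near_root[OF f0 _ ab] by meson
  then obtain \<epsilon> where \<epsilon>: "\<And>\<rho>. poly f \<rho> = 0 \<Longrightarrow> \<exists>A k e. \<epsilon> \<rho> > 0 \<and> A > 0 \<and> k > (0::nat) \<and> e > -1 \<and>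
     (\<forall>x. dist x \<rho> < \<epsilon> \<rho> \<longrightarrow> x \<noteq> \<rho> \<longrightarrow>
     cmod (poly f x) \<le> A * cmod (x - \<rho>) ^ k \<and> cmod (x - \<rho>) ^ k \<le> A * cmod (poly f x) \<and>
     cmod (poly f x / poly (pderiv f) x) \<le> A * cmod (x - \<rho>) \<and>
     cmod (x - 1) powr a * cmod (x + 1) powr b \<le> A * cmod (x - \<rho>) powr e \<and>
     1 / (cmod (x - 1) powr a * cmod (x + 1) powr b) \<le> A * cmod (x - \<rho>) powr - e \<and>
     1 / cmod (1 - x\<^sup>2) \<le> A / cmod (x - \<rho>))"
    by metis
  have "continuous_on {0<..} (\<lambda>r::real. t (of_real r))"
    by (intro continuous_on_compose2[OF holomorphic_on_imp_continuous_on[OF t(1)]] continuous_intros)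
       (use S(2) in auto)
  then obtain \<rho> \<eta> where \<rho>: "poly f \<rho> = 0" and \<eta>: "\<eta> > 0"
    and near: "\<And>r::real. 0 < r \<Longrightarrow> r < \<eta> \<Longrightarrow> dist (t (of_real r)) \<rho> < \<epsilon> \<rho>"
    by (rule inverse_branch_approaches_root[OF f0, of \<epsilon> "\<lambda>r. t (of_real r)", rotated])
       (use \<epsilon> t(2) S(2) in blast)+
  obtain A k e where A: "A > 0" and k: "k > 0" and e: "e > -1"
    and est: "\<And>x. dist x \<rho> < \<epsilon> \<rho> \<Longrightarrow> x \<noteq> \<rho> \<Longrightarrow>
     cmod (poly f x) \<le> A * cmod (x - \<rho>) ^ k \<and> cmod (x - \<rho>) ^ k \<le> A * cmod (poly f x) \<and>
     cmod (poly f x / poly (pderiv f) x) \<le> A * cmod (x - \<rho>) \<and>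
     cmod (x - 1) powr a * cmod (x + 1) powr b \<le> A * cmod (x - \<rho>) powr e \<and>
     1 / (cmod (x - 1) powr a * cmod (x + 1) powr b) \<le> A * cmod (x - \<rho>) powr - e \<and>
     1 / cmod (1 - x\<^sup>2) \<le> A / cmod (x - \<rho>)"
    using \<epsilon>[OF \<rho>] by blast
  define r0 where "r0 = min 1 (\<eta> / 2)"
  have r0: "0 < r0" "r0 \<le> 1" "r0 < \<eta>" using \<eta> by (auto simp: r0_def)
  define \<delta> where "\<delta> r = cmod (t (of_real r) - \<rho>)" for r :: real
  define B where "B p = A powr \<bar>p / k\<bar>" for p
  have B0: "B p \<ge> 0" for p by (simp add: B_def)
  have \<delta>_pos: "\<delta> r > 0" if r: "0 < r" "r \<le> r0" for r
    using t(2)[OF S(2)[OF r(1)]] \<rho> r by (auto simp: \<delta>_def)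
  have ests: "\<delta> r ^ k \<le> A * r" "r \<le> A * \<delta> r ^ k"
      "cmod (of_real r / poly (pderiv f) (t (of_real r))) \<le> A * \<delta> r"
      "cmod (?E (of_real r)) \<le> A * \<delta> r powr e" "1 / cmod (?E (of_real r)) \<le> A * \<delta> r powr - e"
      "1 / cmod (1 - (t (of_real r))\<^sup>2) \<le> A / \<delta> r"
    if r: "0 < r" "r \<le> r0" for r
    using est[OF near[of r]] \<delta>_pos[OF r] r r0 t(2)[OF S(2)[OF r(1)]] norm_E[OF S(2)[OF r(1)]]
    by (auto simp: \<delta>_def)
  have \<delta>_powr: "\<delta> r powr p \<le> B p * r powr (p / k)" if r: "0 < r" "r \<le> r0" for r p
  proof -
    have "\<delta> r powr p = (\<delta> r ^ k) powr (p / k)"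
      using k \<delta>_pos[OF r] by (simp add: powr_realpow[symmetric] powr_powr)
    also have "\<dots> \<le> B p * r powr (p / k)"
      unfolding B_def by (rule powr_comparable) (use ests[OF r] \<delta>_pos[OF r] r in auto)
    finally show ?thesis .
  qed
  show ?thesis
  proof (rule primitive_decay[where ?r0.0 = r0 and q = "e / k" and s = "(1 + e) / k" and c = c
        and u = "\<lambda>r. of_real r / poly (pderiv f) (t (of_real r)) * ?E (of_real r)"
        and \<gamma> = "\<lambda>r. G (of_real r)"
        and \<gamma>' = "\<lambda>r. K * deriv t (of_real r) / ((1 - (t (of_real r))\<^sup>2) * ?E (of_real r))"
        and B = "cmod K * A ^ 3 * B (- e)" and A = "A\<^sup>2 * B (1 + e)"])
    show "e / k < (1 + e) / k" "0 < (1 + e) / k" using k e by (auto simp: divide_strict_right_mono)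
    fix r assume r: "0 < r" "r \<le> r0"
    let ?z = "complex_of_real r"
    let ?w = "of_real r / poly (pderiv f) (t ?z)"
    have z: "?z \<in> S" using S(2) r by auto
    show "((\<lambda>r. G (of_real r)) has_vector_derivative
            K * deriv t ?z / ((1 - (t ?z)\<^sup>2) * ?E ?z)) (at r)"
      by (rule has_vector_derivative_real_field[OF G[OF z]])
    have "poly (pderiv f) (t ?z) \<noteq> 0" using noncritical[of "t ?z"] t(2)[OF z] z by simp
    then have "deriv t ?z = ?w / of_real r"
      using deriv_t[OF z] r by (simp add: field_simps)
    then have "cmod (K * deriv t ?z / ((1 - (t ?z)\<^sup>2) * ?E ?z))
        = cmod K * (cmod ?w * (1 / cmod (1 - (t ?z)\<^sup>2)) * (1 / cmod (?E ?z))) / r"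
      using r by (simp add: norm_mult norm_divide)
    also have "\<dots> \<le> cmod K * ((A * \<delta> r) * (A / \<delta> r) * (A * (B (- e) * r powr (- e / k)))) / r"
      using ests[OF r] \<delta>_powr[OF r, of "- e"] \<delta>_pos[OF r] r A B0
      by (intro divide_right_mono mult_left_mono mult_mono order.trans[OF ests(5)[OF r]]) auto
    also have "\<dots> = cmod K * A ^ 3 * B (- e) * (r powr (- e / k) / r)"
      using \<delta>_pos[OF r] by (simp add: power3_eq_cube)
    also have "r powr (- e / k) / r = r powr (- 1 - e / k)"
      using r by (simp add: powr_diff powr_minus_divide)
    finally show "cmod (K * deriv t ?z / ((1 - (t ?z)\<^sup>2) * ?E ?z))
        \<le> cmod K * A ^ 3 * B (- e) * r powr (- 1 - e / k)" .
    have "cmod (?w * ?E ?z) \<le> (A * \<delta> r) * (A * \<delta> r powr e)"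
      unfolding norm_mult using ests[OF r] A \<delta>_pos[OF r] by (intro mult_mono) auto
    also have "\<dots> = A\<^sup>2 * \<delta> r powr (1 + e)"
      using \<delta>_pos[OF r] by (simp add: powr_add power2_eq_square)
    also have "\<dots> \<le> A\<^sup>2 * (B (1 + e) * r powr ((1 + e) / k))"
      by (intro mult_left_mono \<delta>_powr r) auto
    finally show "cmod (?w * ?E ?z) \<le> A\<^sup>2 * B (1 + e) * r powr ((1 + e) / k)"
      by simp
  qed (use r0 in auto)
qed

section \<open>Continuation along a sector\<close>

text \<open>For \<open>\<epsilon> > 0\<close> the condition forces \<open>Re z > 0\<close>, so this is a convex cone around the positive real axis, without its apex.\<close>

definition sector :: "real \<Rightarrow> complex set" where
  "sector \<epsilon> = {z. \<bar>Im z\<bar> < \<epsilon> * Re z}"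

lemma sector_eq: "sector \<epsilon> = {z. Im z < \<epsilon> * Re z} \<inter> {z. - Im z < \<epsilon> * Re z}"
  by (auto simp: sector_def abs_less_iff)

lemma open_sector: "open (sector \<epsilon>)"
  unfolding sector_eq by (intro open_Int open_Collect_less continuous_intros)

lemma convex_sector: "convex (sector \<epsilon>)"
proof -
  have "linear (\<lambda>z. \<epsilon> * Re z - Im z)" "linear (\<lambda>z. \<epsilon> * Re z + Im z)"
    by (intro linearI; simp add: algebra_simps)+
  then have "convex ((\<lambda>z. \<epsilon> * Re z - Im z) -` {0<..} \<inter> (\<lambda>z. \<epsilon> * Re z + Im z) -` {0<..})"
    by (intro convex_Int convex_linear_vimage) auto
  also have "\<dots> = sector \<epsilon>" by (auto simp: sector_eq)
  finally show ?thesis .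
qed

lemma of_real_in_sector: "\<epsilon> > 0 \<Longrightarrow> r > 0 \<Longrightarrow> of_real r \<in> sector \<epsilon>"
  by (simp add: sector_def)

text \<open>A point \<open>v\<close> off the positive real axis is avoided by every sector of slope at most \<open>\<bar>Im v\<bar> / (\<bar>Re v\<bar> + 1)\<close>, or by
all sectors if it is real; finitely many points give a positive minimum.\<close>

lemma sector_avoiding_finite_set:
  assumes "finite V" and V: "\<And>r::real. r > 0 \<Longrightarrow> of_real r \<notin> V"
  obtains \<epsilon> where "\<epsilon> > 0" "sector \<epsilon> \<inter> V = {}"
proof -
  define e where "e v = (if Im v = 0 then 1 else \<bar>Im v\<bar> / (\<bar>Re v\<bar> + 1))" for v
  have "\<exists>s>0. (\<forall>v\<in>V. s \<le> e v) \<and> (\<forall>x\<in>V. \<forall>y\<in>V. x \<noteq> y \<longrightarrow> ball x s \<inter> ball y s = {})"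
    by (rule finite_separating_radius[OF \<open>finite V\<close>]) (auto simp: e_def intro!: divide_pos_pos)
  then obtain \<epsilon> where \<epsilon>: "\<epsilon> > 0" "\<And>v. v \<in> V \<Longrightarrow> \<epsilon> \<le> e v" by blast
  have "v \<notin> sector \<epsilon>" if v: "v \<in> V" for v
  proof
    assume "v \<in> sector \<epsilon>"
    then have im: "\<bar>Im v\<bar> < \<epsilon> * Re v" by (simp add: sector_def)
    then have re: "Re v > 0" using \<epsilon>(1) by (smt (verit) mult_nonneg_nonpos)
    show False
    proof (cases "Im v = 0")
      case True
      then have "v = of_real (Re v)" by (simp add: complex_eq_iff)
      then show False using V[OF re] v by simp
    next
      case False
      have "\<epsilon> * Re v \<le> \<bar>Im v\<bar> / (\<bar>Re v\<bar> + 1) * Re v"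
        using \<epsilon>(2)[OF v] False re by (intro mult_right_mono) (auto simp: e_def)
      also have "\<dots> \<le> \<bar>Im v\<bar>" using re by (simp add: field_simps)
      finally show False using im by simp
    qed
  qed
  then show ?thesis using that[OF \<epsilon>(1)] by blast
qed

context jacobi_parameters
begin

text \<open>Where \<open>t\<close> is large, \<open>Q(t z)\<close> is defined by its series and solves the differential equation above, so variation of
constants represents it as \<open>E (G + c)\<close>, with \<open>E\<close> the pulled back solution of the homogeneous equation. The right
side makes sense on all of \<open>S\<close>, because \<open>t\<close> avoids the singular points \<open>1\<close> and \<open>-1\<close>.\<close>

lemma cauchy_continuation:
  fixes t :: "complex \<Rightarrow> complex"
  assumes S: "open S" "convex S" and t: "t holomorphic_on S" "\<And>z. z \<in> S \<Longrightarrow> t z \<noteq> 1 \<and> t z \<noteq> -1"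
    and U: "U \<subseteq> S" "open U" "convex U" "\<And>z. z \<in> U \<Longrightarrow> cmod (t z) > 1"
  obtains l1 l2 G c where "l1 holomorphic_on S" "l2 holomorphic_on S"
    "\<And>z. z \<in> S \<Longrightarrow> t z - 1 = exp (l1 z)" "\<And>z. z \<in> S \<Longrightarrow> t z + 1 = exp (l2 z)"
    "\<And>z. z \<in> S \<Longrightarrow> (G has_field_derivative of_real (1 + a + b) * deriv t z
        / ((1 - (t z)\<^sup>2) * exp (of_real a * l1 z + of_real b * l2 z))) (at z)"
    "\<And>z. z \<in> U \<Longrightarrow> cauchy_transform (t z) 1 = exp (of_real a * l1 z + of_real b * l2 z) * (G z + c)"
proof -
  have contr: "contractible S" by (rule convex_imp_contractible[OF S(2)])
  have hol: "(\<lambda>z. t z - 1) holomorphic_on S" "(\<lambda>z. t z + 1) holomorphic_on S"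
    by (intro holomorphic_intros t(1))+
  have "t z - 1 \<noteq> 0" "t z + 1 \<noteq> 0" if "z \<in> S" for z
    using t(2)[OF that] by (auto simp: add_eq_0_iff2)
  note logs = contractible_imp_holomorphic_log[OF hol(1) contr this(1)]
    contractible_imp_holomorphic_log[OF hol(2) contr this(2)]
  obtain l1 where l1: "l1 holomorphic_on S" "\<And>z. z \<in> S \<Longrightarrow> t z - 1 = exp (l1 z)"
    using logs(1) by blast
  obtain l2 where l2: "l2 holomorphic_on S" "\<And>z. z \<in> S \<Longrightarrow> t z + 1 = exp (l2 z)"
    using logs(2) by blast
  define E where "E z = exp (of_real a * l1 z + of_real b * l2 z)" for z
  define C where "C = complex_of_real (1 + a + b)"
  have nz: "1 - (t z)\<^sup>2 \<noteq> 0" if "z \<in> S" for z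
    using t(2)[OF that] by (auto simp: power2_eq_1_iff)
  have "(\<lambda>z. C * deriv t z / ((1 - (t z)\<^sup>2) * E z)) holomorphic_on S"
    unfolding E_def by (intro holomorphic_intros holomorphic_deriv t(1) l1(1) l2(1) S(1)) (use nz in auto)
  from holomorphic_convex_primitive'[OF S(2,1) this]
  obtain G where "\<And>z. z \<in> S \<Longrightarrow> (G has_field_derivative C * deriv t z / ((1 - (t z)\<^sup>2) * E z)) (at z within S)"
    by blast
  then have G: "(G has_field_derivative C * deriv t z / ((1 - (t z)\<^sup>2) * E z)) (at z)" if "z \<in> S" for z
    using that S(1) by (metis at_within_open)
  have "((\<lambda>z. cauchy_transform (t z) 1 / E z - G z) has_field_derivative 0) (at z within U)" if zU: "z \<in> U" for z
  proof -
    have z: "z \<in> S" using zU U(1) by blast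
    define D where "D = deriv t z"
    have t': "(t has_field_derivative D) (at z)"
      unfolding D_def using t(1) S(1) z by (rule holomorphic_derivI)
    have l1': "(l1 has_field_derivative deriv l1 z) (at z)"
      using l1(1) S(1) z by (rule holomorphic_derivI)
    have l2': "(l2 has_field_derivative deriv l2 z) (at z)"
      using l2(1) S(1) z by (rule holomorphic_derivI)
    have "((\<lambda>z. t z - 1) has_field_derivative exp (l1 z) * deriv l1 z) (at z)"
      by (rule has_field_derivative_transform_within_open[of "\<lambda>z. exp (l1 z)" _ _ S])
         (auto intro!: derivative_eq_intros l1' S(1) z simp: l1(2))
    moreover have "((\<lambda>z. t z - 1) has_field_derivative D) (at z)"
      by (auto intro!: derivative_eq_intros t')
    ultimately have d1: "(t z - 1) * deriv l1 z = D"
      unfolding l1(2)[OF z] by (rule DERIV_unique)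
    have "((\<lambda>z. t z + 1) has_field_derivative exp (l2 z) * deriv l2 z) (at z)"
      by (rule has_field_derivative_transform_within_open[of "\<lambda>z. exp (l2 z)" _ _ S])
         (auto intro!: derivative_eq_intros l2' S(1) z simp: l2(2))
    moreover have "((\<lambda>z. t z + 1) has_field_derivative D) (at z)"
      by (auto intro!: derivative_eq_intros t')
    ultimately have d2: "(t z + 1) * deriv l2 z = D"
      unfolding l2(2)[OF z] by (rule DERIV_unique)
    \<comment> \<open>\<open>w\<close> is the logarithmic derivative of \<open>E\<close>\<close>
    define w where "w = of_real a * deriv l1 z + of_real b * deriv l2 z"
    have w: "(1 - (t z)\<^sup>2) * w = - (of_real (a + b) * t z + of_real (a - b)) * D"
    proof -
      have "(1 - (t z)\<^sup>2) * w = - (of_real a * (t z + 1) * ((t z - 1) * deriv l1 z)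
              + of_real b * (t z - 1) * ((t z + 1) * deriv l2 z))"
        by (simp add: w_def algebra_simps power2_eq_square)
      then show ?thesis unfolding d1 d2 by (simp add: algebra_simps)
    qed
    have E': "(E has_field_derivative E z * w) (at z)"
      unfolding E_def w_def by (auto intro!: derivative_eq_intros l1' l2')
    have Ez: "E z \<noteq> 0" by (simp add: E_def)
    define Q where "Q = cauchy_transform (t z) 1"
    have Q': "((\<lambda>z. cauchy_transform (t z) 1) has_field_derivative
        (C - (of_real (a + b) * t z + of_real (a - b)) * Q) / (1 - (t z)\<^sup>2) * D) (at z)"
      unfolding C_def Q_def
      by (rule DERIV_chain2[OF cauchy_transform_differential_equation[OF U(4)[OF zU]] t'])
    have "((\<lambda>z. cauchy_transform (t z) 1 / E z - G z) has_field_derivative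
        ((C - (of_real (a + b) * t z + of_real (a - b)) * Q) / (1 - (t z)\<^sup>2) * D * E z - Q * (E z * w)) / (E z * E z)
         - C * deriv t z / ((1 - (t z)\<^sup>2) * E z)) (at z)"
      unfolding Q_def by (intro DERIV_diff DERIV_divide E' Q'[unfolded Q_def] G z Ez)
    moreover have "((C - (of_real (a + b) * t z + of_real (a - b)) * Q) / (1 - (t z)\<^sup>2) * D * E z - Q * (E z * w)) / (E z * E z)
         - C * deriv t z / ((1 - (t z)\<^sup>2) * E z) = 0"
    proof -
      have cancel: "((C - p * Q) / M * D * e - Q * (e * w)) / (e * e) - C * D / (M * e) = 0"
        if "M \<noteq> 0" "e \<noteq> 0" "M * w = - p * D" for M e p :: complex
      proof -
        have w_eq: "w = - p * D / M" using that by (simp add: field_simps)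
        show ?thesis unfolding w_eq using that(1,2) by (simp add: field_simps)
      qed
      show ?thesis
        unfolding D_def[symmetric] by (rule cancel[OF nz[OF z] Ez w])
    qed
    ultimately show ?thesis using has_field_derivative_at_within by metis
  qed
  from has_field_derivative_zero_constant[OF U(3) this]
  obtain c where c: "\<And>z. z \<in> U \<Longrightarrow> cauchy_transform (t z) 1 / E z - G z = c" by blast
  have "cauchy_transform (t z) 1 = E z * (G z + c)" if "z \<in> U" for z
    using c[OF that] by (simp add: E_def field_simps)
  then show ?thesis
    using that[OF l1(1) l2(1) l1(2) l2(2), of G c] G unfolding E_def C_def by blast
qed

text \<open>The functions \<open>F\<close> and \<open>P\<close> of the proof are the two expressions for \<open>mean (z / (z - f))\<close>: the sum over the branches,
which tends to \<open>0\<close> at the origin, and the polynomial in \<open>1 / z\<close>, whose constant term is \<open>1\<close>.\<close>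

lemma eventual_vanishing_impossible_on_good_ray:
  assumes deg: "degree f > 0" and vanish: "\<And>m. m \<ge> N \<Longrightarrow> mean (f ^ m) = 0"
    and regular: "\<And>x r. r > 0 \<Longrightarrow> poly f x = of_real r \<Longrightarrow> poly (pderiv f) x \<noteq> 0 \<and> x \<noteq> 1 \<and> x \<noteq> -1"
  shows False
proof -
  define V where "V = poly f ` ({x. poly (pderiv f) x = 0} \<union> {1, -1})"
  have "pderiv f \<noteq> 0" using deg by (simp add: pderiv_eq_0_iff)
  then have "finite V" unfolding V_def by (intro finite_imageI finite_UnI poly_roots_finite) auto
  moreover have "of_real r \<notin> V" if "r > 0" for r :: real
  proof
    assume "of_real r \<in> V"
    then obtain x where x: "of_real r = poly f x" "x \<in> {x. poly (pderiv f) x = 0} \<union> {1, -1}"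
      unfolding V_def by (rule imageE)
    show False using regular[OF that x(1)[symmetric]] x(2) by simp
  qed
  ultimately obtain \<epsilon> where \<epsilon>: "\<epsilon> > 0" "sector \<epsilon> \<inter> V = {}"
    using sector_avoiding_finite_set by blast
  define S where "S = sector \<epsilon>"
  have S: "open S" "convex S" "\<And>r::real. r > 0 \<Longrightarrow> of_real r \<in> S"
    using \<epsilon>(1) by (auto simp: S_def open_sector convex_sector of_real_in_sector)
  have noncritical: "poly (pderiv f) x \<noteq> 0" and not_end: "x \<noteq> 1" "x \<noteq> -1" if "poly f x \<in> S" for x
    using that \<epsilon>(2) unfolding S_def V_def by blast+
  \<comment> \<open>on the unit ball around \<open>z0\<close> the values exceed \<open>coeff_norm f\<close>, so that \<open>sum_cauchy_over_fibre\<close> applies\<close>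
  define z0 where "z0 = complex_of_real (coeff_norm f + 1)"
  have z0: "z0 \<in> S" using S(3)[of "coeff_norm f + 1"] coeff_norm_nonneg[of f] by (simp add: z0_def)
  let ?R = "{x. poly f x = z0}"
  obtain g where g_hol: "\<And>x. poly f x = z0 \<Longrightarrow> g x holomorphic_on S"
    and g_bij: "\<And>z. z \<in> S \<Longrightarrow> bij_betw (\<lambda>x. g x z) ?R {y. poly f y = z}"
    using holomorphic_inverse_branches[OF deg S(1,2) z0 noncritical] by blast
  have fg: "poly f (g x z) = z" if "x \<in> ?R" "z \<in> S" for x z
    using g_bij[OF that(2)] that(1) unfolding bij_betw_def by blast
  define U where "U = S \<inter> ball z0 1"
  have U: "U \<subseteq> S" "open U" "convex U" "z0 \<in> U"
    using S z0 by (auto simp: U_def convex_Int)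
  have U_large: "cmod z > coeff_norm f" if "z \<in> U" for z
  proof -
    have "cmod z0 - cmod z < 1"
      using that norm_triangle_ineq2[of z0 z] by (simp add: U_def dist_norm)
    moreover have "cmod z0 = coeff_norm f + 1"
      unfolding z0_def norm_of_real using coeff_norm_nonneg[of f] by simp
    ultimately show ?thesis by simp
  qed
  define continuation where "continuation x l1 l2 G c \<longleftrightarrow> l1 holomorphic_on S \<and> l2 holomorphic_on S \<and>
      (\<forall>z\<in>S. g x z - 1 = exp (l1 z)) \<and> (\<forall>z\<in>S. g x z + 1 = exp (l2 z)) \<and>
      (\<forall>z\<in>S. (G has_field_derivative of_real (1 + a + b) * deriv (g x) z
        / ((1 - (g x z)\<^sup>2) * exp (of_real a * l1 z + of_real b * l2 z))) (at z)) \<and>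
      (\<forall>z\<in>U. cauchy_transform (g x z) 1 = exp (of_real a * l1 z + of_real b * l2 z) * (G z + c))"
    for x l1 l2 G c
  have "\<exists>l1 l2 G c. continuation x l1 l2 G c" if x: "x \<in> ?R" for x
  proof -
    have ends: "g x z \<noteq> 1 \<and> g x z \<noteq> -1" if "z \<in> S" for z
      using not_end[of "g x z"] fg[OF x that] that by simp
    have large: "cmod (g x z) > 1" if "z \<in> U" for z
      using norm_poly_le_coeff_norm[of "g x z" f] U_large[OF that] fg[OF x, of z] that U(1) by force
    have hol: "g x holomorphic_on S" using g_hol x by simp
    show ?thesis
      unfolding continuation_def
      by (rule cauchy_continuation[OF S(1,2) hol ends U(1-3) large]) blast+
  qed
  then obtain l1 l2 G c where good: "\<And>x. x \<in> ?R \<Longrightarrow> continuation x (l1 x) (l2 x) (G x) (c x)"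
    by metis
  have l: "l1 x holomorphic_on S" "l2 x holomorphic_on S" if "x \<in> ?R" for x
    using good[OF that] by (simp_all add: continuation_def)
  have exp_l: "g x z - 1 = exp (l1 x z)" "g x z + 1 = exp (l2 x z)" if "x \<in> ?R" "z \<in> S" for x z
    using good[OF that(1)] that(2) unfolding continuation_def by blast+
  have G: "(G x has_field_derivative of_real (1 + a + b) * deriv (g x) z
        / ((1 - (g x z)\<^sup>2) * exp (of_real a * l1 x z + of_real b * l2 x z))) (at z)"
    if "x \<in> ?R" "z \<in> S" for x z
    using good[OF that(1)] that(2) unfolding continuation_def by blast
  have cont: "cauchy_transform (g x z) 1 = exp (of_real a * l1 x z + of_real b * l2 x z) * (G x z + c x)"
    if "x \<in> ?R" "z \<in> U" for x z
    using good[OF that(1)] that(2) unfolding continuation_def by blast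
  define F where "F z = (\<Sum>x\<in>?R. z / poly (pderiv f) (g x z)
      * exp (of_real a * l1 x z + of_real b * l2 x z) * (G x z + c x))" for z
  define P where "P z = (\<Sum>m<N. mean (f ^ m) / z ^ m)" for z
  have S0: "0 \<notin> S" by (simp add: S_def sector_def)
  have F_eq_P: "F z = P z" if "z \<in> S" for z
  proof (rule analytic_continuation_open[of U S F P])
    have "(\<lambda>z. z / poly (pderiv f) (g x z) * exp (of_real a * l1 x z + of_real b * l2 x z)
        * (G x z + c x)) holomorphic_on S" if x: "x \<in> ?R" for x
    proof -
      have "g x holomorphic_on S" using g_hol x by simp
      moreover have "G x holomorphic_on S"
        using G[OF x] S(1) by (auto simp: holomorphic_on_open)
      moreover have "poly (pderiv f) (g x z) \<noteq> 0" if "z \<in> S" for z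
        using fg[OF x that] noncritical[of "g x z"] that by simp
      ultimately show ?thesis
        using l[OF x] by (intro holomorphic_intros) auto
    qed
    then show "F holomorphic_on S"
      unfolding F_def by (intro holomorphic_on_sum)
    show "P holomorphic_on S"
      unfolding P_def by (intro holomorphic_intros) (use S0 in auto)
    fix z assume z: "z \<in> U"
    then have zS: "z \<in> S" using U(1) by blast
    have "F z = (\<Sum>x\<in>?R. z * (cauchy_transform (g x z) 1 / poly (pderiv f) (g x z)))"
      unfolding F_def by (rule sum.cong) (use cont z in auto)
    also have "\<dots> = (\<Sum>y | poly f y = z. z * (cauchy_transform y 1 / poly (pderiv f) y))"
      by (rule sum.reindex_bij_betw[OF g_bij[OF zS]])
    also have "\<dots> = z * (\<Sum>m<N. mean (f ^ m) / z ^ Suc m)"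
      unfolding sum_distrib_left[symmetric]
      by (subst sum_cauchy_over_fibre[OF deg _ U_large[OF z] vanish]) (use noncritical zS in auto)
    also have "\<dots> = P z"
      unfolding P_def sum_distrib_left by (rule sum.cong) (use zS S0 in auto)
    finally show "F z = P z" .
  qed (use U S that in \<open>auto intro: convex_connected\<close>)
  have "((\<lambda>r. F (of_real r)) \<longlongrightarrow> (\<Sum>x\<in>?R. 0)) (at_right 0)"
    unfolding F_def
  proof (rule tendsto_sum)
    fix x assume x: "x \<in> ?R"
    show "((\<lambda>r. of_real r / poly (pderiv f) (g x (of_real r))
        * exp (of_real a * l1 x (of_real r) + of_real b * l2 x (of_real r)) * (G x (of_real r) + c x)) \<longlongrightarrow> 0) (at_right 0)"
      by (rule branch_contribution_vanishes[OF a_gt b_gt deg S(1,3) _ _ noncritical exp_l[OF x] G[OF x]])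
         (use g_hol fg x in auto)
  qed
  moreover have "filterlim (\<lambda>n. 1 / real (Suc n)) (at_right 0) sequentially"
    by real_asymp
  ultimately have "(\<lambda>n. F (of_real (1 / real (Suc n)))) \<longlonglongrightarrow> 0"
    using filterlim_compose by fastforce
  moreover have "F (of_real (1 / real (Suc n))) = P (of_real (1 / real (Suc n)))" for n
    by (rule F_eq_P[OF S(3)]) simp
  ultimately have lim: "(\<lambda>n. P (of_real (1 / real (Suc n)))) \<longlonglongrightarrow> 0" by simp
  define q where "q = (\<Sum>m<N. monom (mean (f ^ m)) m)"
  have P_q: "P (of_real (1 / real (Suc n))) = poly q (of_nat (Suc n))" for n
    by (simp add: P_def q_def poly_sum poly_monom power_one_over divide_simps del: of_nat_Suc)
  \<comment> \<open>\<open>mean (f ^ 0) = 1\<close> is among the terms of \<open>P\<close>\<close>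
  have N: "N > 0" using vanish[of 0] by (cases N) auto
  have "coeff q 0 = (\<Sum>m<N. if m = 0 then mean (f ^ m) else 0)"
    unfolding q_def coeff_sum by (rule sum.cong) auto
  then have q0: "coeff q 0 = 1" using N by simp
  show False
  proof (cases "degree q = 0")
    case True
    then obtain d where "q = [:d:]" by (rule degree_eq_zeroE)
    then have "P (of_real (1 / real (Suc n))) = 1" for n unfolding P_q using q0 by simp
    with lim show False by (simp add: LIMSEQ_const_iff)
  next
    case False
    have "filterlim (\<lambda>n. complex_of_nat (Suc n)) at_infinity sequentially"
      by (rule filterlim_compose[OF tendsto_of_nat filterlim_Suc])
    then have "filterlim (\<lambda>n. poly q (of_nat (Suc n))) at_infinity sequentially"
      using False by (intro filterlim_compose[OF filterlim_poly_at_infinity]) auto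
    with lim show False
      unfolding P_q using not_tendsto_and_filterlim_at_infinity[OF sequentially_bot] by blast
  qed
qed

text \<open>Multiplying \<open>f\<close> by a constant \<open>u\<close> with \<open>\<bar>u\<bar> = 1\<close> multiplies \<open>mean (f ^ m)\<close> by \<open>u ^ m\<close>, so the values of \<open>f\<close> may
be rotated until the positive real axis contains none of the finitely many exceptional ones.\<close>

lemma mean_powers_not_eventually_zero:
  assumes "f \<noteq> 0" and vanish: "\<And>m. m \<ge> N \<Longrightarrow> mean (f ^ m) = 0"
  shows False
proof (cases "degree f = 0")
  case True
  then obtain c where c: "f = [:c:]" by (rule degree_eq_zeroE)
  have "f ^ m = smult (c ^ m) 1" for m by (induction m) (auto simp: c)
  then have "mean (f ^ N) = c ^ N" by (simp only: mean_smult mean_1 mult_1_right)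
  with vanish[of N] c \<open>f \<noteq> 0\<close> show False by simp
next
  case False
  define V where "V = poly f ` ({x. poly (pderiv f) x = 0} \<union> {1, -1})"
  have "pderiv f \<noteq> 0" using False by (simp add: pderiv_eq_0_iff)
  then have "finite V" unfolding V_def by (intro finite_imageI finite_UnI poly_roots_finite) auto
  \<comment> \<open>the numbers of modulus one that rotate some point of \<open>V\<close> to the positive real axis\<close>
  let ?W = "(\<lambda>v. of_real (cmod v) / v) ` V"
  \<comment> \<open>there are more roots of unity of this order than elements of \<open>?W\<close>\<close>
  have "\<not> {z::complex. z ^ Suc (card ?W) = 1} \<subseteq> ?W"
  proof
    assume "{z::complex. z ^ Suc (card ?W) = 1} \<subseteq> ?W"
    then have "card {z::complex. z ^ Suc (card ?W) = 1} \<le> card ?W"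
      by (rule card_mono[OF finite_imageI[OF \<open>finite V\<close>]])
    then show False using card_roots_unity_eq[of "Suc (card ?W)"] by simp
  qed
  then obtain u :: complex where "u ^ Suc (card ?W) = 1" and u_W: "u \<notin> ?W" by blast
  then have u: "cmod u = 1" using power_eq_1_iff by blast
  have not_pos: "u * v \<noteq> of_real r" if "v \<in> V" "r > 0" for v and r :: real
  proof
    assume eq: "u * v = of_real r"
    then have "cmod v = r" using u that(2) by (metis abs_of_pos mult_1 norm_mult norm_of_real)
    with eq that have "u = of_real (cmod v) / v" by (auto simp: field_simps)
    then show False using u_W that(1) by blast
  qed
  show False
  proof (rule eventual_vanishing_impossible_on_good_ray[of "smult u f" N])
    have u0: "u \<noteq> 0" using u by auto
    show "degree (smult u f) > 0" using False u0 by simp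
    show "mean (smult u f ^ m) = 0" if "m \<ge> N" for m
      using vanish[OF that] by (simp add: smult_power mean_smult)
    show "poly (pderiv (smult u f)) x \<noteq> 0 \<and> x \<noteq> 1 \<and> x \<noteq> -1"
      if r: "r > 0" and eq: "poly (smult u f) x = of_real r" for x r
    proof -
      have "poly f x \<notin> V" using not_pos[of "poly f x" r] r eq by auto
      then show ?thesis using u0 by (auto simp: V_def pderiv_smult)
    qed
  qed
qed

end

section \<open>The radical of the image\<close>

lemma power_radical_jacobi_image:
  fixes \<alpha> \<beta> :: real
  assumes "\<alpha> > -1" "\<beta> > -1" "\<alpha> \<noteq> 0" "\<beta> \<noteq> 0"
  shows "power_radical (poly_image (jacobi_op \<alpha> \<beta>)) = {0}"
proof -
  interpret jacobi_parameters \<alpha> \<beta>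
    by unfold_locales (use assms in auto)
  have "f = 0" if f: "f \<in> power_radical (poly_image (jacobi_op \<alpha> \<beta>))" for f
  proof (rule ccontr)
    assume "f \<noteq> 0"
    obtain N where "\<And>m. m \<ge> N \<Longrightarrow> f ^ m \<in> poly_image (jacobi_op \<alpha> \<beta>)"
      using f by (auto simp: power_radical_def eventually_sequentially)
    then show False
      by (intro mean_powers_not_eventually_zero[OF \<open>f \<noteq> 0\<close>, of N] mean_vanishes_on_image assms)
  qed
  moreover have "0 \<in> power_radical (poly_image (jacobi_op \<alpha> \<beta>))"
  proof -
    have "to_fract 0 = jacobi_op \<alpha> \<beta> 0" by (simp add: jacobi_op_def)
    then have zero: "0 \<in> poly_image (jacobi_op \<alpha> \<beta>)"
      unfolding poly_image_def by (auto intro: range_eqI)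
    have "\<forall>\<^sub>F m in sequentially. (0 :: complex poly) ^ m \<in> poly_image (jacobi_op \<alpha> \<beta>)"
      using eventually_gt_at_top[of 0] by eventually_elim (simp add: zero zero_power)
    then show ?thesis by (simp add: power_radical_def)
  qed
  ultimately show ?thesis by blast
qed

theorem corollary6p10:
  fixes \<alpha> \<beta> :: real
  assumes "\<alpha> > -1" and "\<beta> > -1" and "\<not> (\<alpha> = 0 \<and> \<beta> = 0)"
  shows "(\<alpha> \<in> \<nat> \<and> \<beta> \<in> \<nat> \<longrightarrow>
            strong_image_conjecture (jacobi_op \<alpha> \<beta>) \<and>
            (\<alpha> \<noteq> 0 \<and> \<beta> \<noteq> 0 \<longrightarrow> power_radical (poly_image (jacobi_op \<alpha> \<beta>)) = {0})) \<and>
         (\<forall>l::real. 2 * l \<in> \<nat> \<and> \<alpha> = l - 1/2 \<and> \<beta> = l - 1/2 \<longrightarrow>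
            power_radical (poly_image (jacobi_op \<alpha> \<beta>)) = {0})"
proof -
  have radical: "power_radical (poly_image (jacobi_op \<alpha> \<beta>)) = {0}" if "\<alpha> \<noteq> 0" "\<beta> \<noteq> 0"
    using power_radical_jacobi_image assms(1,2) that by blast
  have "1 \<in> poly_image (jacobi_op \<alpha> \<beta>)" if "\<alpha> = 0 \<or> \<beta> = 0"
    using that one_in_poly_image_left_zero[of \<beta>] one_in_poly_image_right_zero[of \<alpha>] assms(1,2) by auto
  then have "strong_image_conjecture (jacobi_op \<alpha> \<beta>)"
    using radical unfolding strong_image_conjecture_def by blast
  moreover have "\<alpha> \<noteq> 0 \<and> \<beta> \<noteq> 0" if "\<alpha> = l - 1/2" "\<beta> = l - 1/2" for l
    using assms(3) that by auto
  ultimately show ?thesis using radical by blast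
qed

end
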